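(* Let $F$ be an infinite field of positive characteristic $p>2$, let $m\ge 1$ be an integer, let $k\in\mathbb{N}$, and let $E_d$, with $d\in\{k^*,\infty,k\}$, be one of the $\mathbb{Z}_2$-graded Grassmann algebras $E_{k^*}$, $E_\infty$, $E_k$ over $F$. Let $I=T_{\mathbb{Z}_2}(E_d)\cap F\langle y_1,\dots,y_m,z_1,\dots,z_m\rangle$ and $A=F\langle y_1,\dots,y_m,z_1,\dots,z_m\rangle/I$. Then the Gelfand-Kirillov dimension of $A$ is $m$ except in the case $d=\infty$.
   Context: All algebras are associative and unitary. $E$ is the infinite dimensional unitary Grassmann algebra over $F$, generated by $e_1,e_2,\dots$ with relations $e_ie_j+e_je_i=0$ for all $i,j$; it has basis $\{e_{i_1}\cdots e_{i_n}\mid n\ge 0,\ i_1<\cdots<i_n\}$. A $\mathbb{Z}_2$-grading $E=E^0\oplus E^1$ is induced by assigning a degree in $\mathbb{Z}_2$ to each $e_i$ (a monomial has degree the sum of the degrees of its factors): - $E_{k^*}$: $\deg(e_i)=1$ for $i=1,\dots,k$ and $\deg(e_i)=0$ otherwise; - $E_\infty$: $\deg(e_i)=1$ for $i$ odd and $\deg(e_i)=0$ for $i$ even; - $E_k$: $\deg(e_i)=0$ for $i=1,\dots,k$ and $\deg(e_i)=1$ otherwise. In the free associative algebra the variables $y_i$ have $\mathbb{Z}_2$-degree $0$ and the variables $z_i$ have $\mathbb{Z}_2$-degree $1$. $T_{\mathbb{Z}_2}(E_d)$ is the ideal of $\mathbb{Z}_2$-graded polynomial identities of $E_d$, i.e.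 the graded polynomials that vanish whenever the $y_i$ are replaced by arbitrary elements of $E_d^0$ and the $z_i$ by arbitrary elements of $E_d^1$. *)

theory Defs
  imports
    Complex_Main
    "HOL-Algebra.QuotRing"
    "HOL-Algebra.Embedded_Algebras"
    "HOL-Library.Poly_Mapping"
    "HOL-Library.FSet"
    "HOL-Library.Z2"
    "HOL-Library.Extended_Real"
begin

section \<open>The Grassmann algebra\<close>

text \<open>
  An element is given by its coordinates in the basis of monomials
  \<open>e\<^sub>i\<^sub>1 \<cdots> e\<^sub>i\<^sub>n\<close> with \<open>i\<^sub>1 < \<cdots> < i\<^sub>n\<close>. Such a monomial is encoded by the finite set of its
  indices, shifted by one: \<open>j\<close> in the set stands for the generator \<open>e\<^bsub>j+1\<^esub>\<close>.
\<close>

typedef (overloaded) 'a grassmann = "UNIV :: (nat fset \<Rightarrow>\<^sub>0 'a::zero) set"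
  morphisms coords Grassmann ..

setup_lifting type_definition_grassmann

text \<open>
  The structure constants: \<open>e\<^sub>S e\<^sub>T = 0\<close> if \<open>S\<close> and \<open>T\<close> meet, and otherwise
  \<open>e\<^sub>S e\<^sub>T = (-1)\<^sup>r e\<^bsub>S \<union> T\<^esub>\<close>, where \<open>r\<close> is the number of transpositions needed to sort.
\<close>

definition mon_sign :: "nat fset \<Rightarrow> nat fset \<Rightarrow> 'a::ring_1" where
  "mon_sign S T =
     (if S |\<inter>| T = {||}
      then (- 1) ^ card {(i, j). i |\<in>| S \<and> j |\<in>| T \<and> j < i} else 0)"

definition coords_mult ::
  "(nat fset \<Rightarrow>\<^sub>0 'a::comm_ring_1) \<Rightarrow> (nat fset \<Rightarrow>\<^sub>0 'a) \<Rightarrow> (nat fset \<Rightarrow>\<^sub>0 'a)" where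
  "coords_mult x y =
     (\<Sum>S\<in>Poly_Mapping.keys x. \<Sum>T\<in>Poly_Mapping.keys y.
        Poly_Mapping.single (S |\<union>| T)
          (mon_sign S T * Poly_Mapping.lookup x S * Poly_Mapping.lookup y T))"

lemma coords_mult_superset:
  assumes "finite A" "finite B" "Poly_Mapping.keys x \<subseteq> A" "Poly_Mapping.keys y \<subseteq> B"
  shows "coords_mult x y =
     (\<Sum>S\<in>A. \<Sum>T\<in>B. Poly_Mapping.single (S |\<union>| T)
          (mon_sign S T * Poly_Mapping.lookup x S * Poly_Mapping.lookup y T))"
proof -
  have inner: "(\<Sum>T\<in>Poly_Mapping.keys y. Poly_Mapping.single (S |\<union>| T)
          (mon_sign S T * Poly_Mapping.lookup x S * Poly_Mapping.lookup y T))
      = (\<Sum>T\<in>B. Poly_Mapping.single (S |\<union>| T)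
          (mon_sign S T * Poly_Mapping.lookup x S * Poly_Mapping.lookup y T))" for S
    by (rule sum.mono_neutral_left) (use assms in \<open>auto simp: in_keys_iff\<close>)
  show ?thesis unfolding coords_mult_def inner
    by (rule sum.mono_neutral_left) (use assms in \<open>auto simp: in_keys_iff\<close>)
qed

lemma coords_mult_add_left: "coords_mult (x + x') y = coords_mult x y + coords_mult x' y"
proof -
  let ?A = "Poly_Mapping.keys x \<union> Poly_Mapping.keys x'"
  have "Poly_Mapping.keys (x + x') \<subseteq> ?A" by (rule Poly_Mapping.keys_add)
  then show ?thesis
    by (simp add: coords_mult_superset[of ?A "Poly_Mapping.keys y"] lookup_add algebra_simps
        single_add sum.distrib)
qed

lemma coords_mult_add_right: "coords_mult x (y + y') = coords_mult x y + coords_mult x y'"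
proof -
  let ?B = "Poly_Mapping.keys y \<union> Poly_Mapping.keys y'"
  have "Poly_Mapping.keys (y + y') \<subseteq> ?B" by (rule Poly_Mapping.keys_add)
  then show ?thesis
    by (simp add: coords_mult_superset[of "Poly_Mapping.keys x" ?B] lookup_add algebra_simps
        single_add sum.distrib)
qed

lemma coords_mult_single:
  "coords_mult (Poly_Mapping.single S a) (Poly_Mapping.single T b) =
     Poly_Mapping.single (S |\<union>| T) (mon_sign S T * a * b)"
  by (simp add: coords_mult_superset[of "{S}" "{T}"])

lemma coords_mult_zero [simp]: "coords_mult 0 y = 0" "coords_mult x 0 = 0"
  by (simp_all add: coords_mult_def)

lemma poly_mapping_add_induct [case_names zero single add]:
  assumes "P 0" "\<And>k a. P (Poly_Mapping.single k a)" "\<And>f g. P f \<Longrightarrow> P g \<Longrightarrow> P (f + g)"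
  shows "P (f :: 'k \<Rightarrow>\<^sub>0 'a::comm_monoid_add)"
proof (induction f rule: Poly_Mapping.update_induct)
  case const
  show ?case by fact
next
  case (update f a b)
  have "Poly_Mapping.update a b f = f + Poly_Mapping.single a b"
    using update(1)
    by (intro poly_mapping_eqI)
      (auto simp: lookup_update lookup_add lookup_single in_keys_iff when_def)
  then show ?case using assms update by simp
qed

lemma mon_sign_empty [simp]: "mon_sign {||} T = 1" "mon_sign S {||} = 1"
  by (simp_all add: mon_sign_def)

lemma mon_sign_assoc:
  "mon_sign S T * mon_sign (S |\<union>| T) U = (mon_sign T U * mon_sign S (T |\<union>| U) :: 'a::comm_ring_1)"
proof (cases "S |\<inter>| T = {||} \<and> S |\<inter>| U = {||} \<and> T |\<inter>| U = {||}")
  case True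
  define iv where "iv A B = {(i, j). i |\<in>| A \<and> j |\<in>| B \<and> j < (i::nat)}" for A B
  have fin: "finite (iv A B)" for A B
    by (rule finite_subset[of _ "fset A \<times> fset B"]) (auto simp: iv_def)
  have "card (iv (S |\<union>| T) U) = card (iv S U \<union> iv T U)"
    by (rule arg_cong[of _ _ card]) (auto simp: iv_def)
  also have "\<dots> = card (iv S U) + card (iv T U)"
    using True by (intro card_Un_disjoint fin) (auto simp: iv_def)
  finally have 1: "card (iv (S |\<union>| T) U) = card (iv S U) + card (iv T U)" .
  have "card (iv S (T |\<union>| U)) = card (iv S T \<union> iv S U)"
    by (rule arg_cong[of _ _ card]) (auto simp: iv_def)
  also have "\<dots> = card (iv S T) + card (iv S U)"
    using True by (intro card_Un_disjoint fin) (auto simp: iv_def)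
  finally have 2: "card (iv S (T |\<union>| U)) = card (iv S T) + card (iv S U)" .
  have d: "(S |\<union>| T) |\<inter>| U = {||}" "S |\<inter>| (T |\<union>| U) = {||}" using True by auto
  show ?thesis
    unfolding mon_sign_def iv_def[symmetric] using True d
    by (simp add: 1 2 power_add algebra_simps)
next
  case False
  then show ?thesis unfolding mon_sign_def by (auto split: if_splits)
qed

lemma coords_mult_assoc: "coords_mult (coords_mult x y) z = coords_mult x (coords_mult y z)"
proof (induction x rule: poly_mapping_add_induct)
  case (single S a)
  show ?case
  proof (induction y rule: poly_mapping_add_induct)
    case (single T b)
    show ?case
    proof (induction z rule: poly_mapping_add_induct)
      case (single U c)
      have "mon_sign (S |\<union>| T) U * (mon_sign S T * a * b) * c
          = (mon_sign S T * mon_sign (S |\<union>| T) U) * (a * b * c)" by (simp add: ac_simps)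
      also have "\<dots> = mon_sign S (T |\<union>| U) * a * (mon_sign T U * b * c)"
        unfolding mon_sign_assoc by (simp add: ac_simps)
      finally show ?case by (simp add: coords_mult_single sup_assoc)
    qed (simp_all add: coords_mult_add_right)
  qed (simp_all add: coords_mult_add_right coords_mult_add_left)
qed (simp_all add: coords_mult_add_left)

lemma coords_mult_one:
  "coords_mult (Poly_Mapping.single {||} 1) x = x" "coords_mult x (Poly_Mapping.single {||} 1) = x"
  by (induction x rule: poly_mapping_add_induct;
      simp add: coords_mult_single coords_mult_add_right coords_mult_add_left)+

instantiation grassmann :: (comm_ring_1) ring_1
begin

lift_definition zero_grassmann :: "'a grassmann" is 0 .
lift_definition one_grassmann :: "'a grassmann" is "Poly_Mapping.single {||} 1" .
lift_definition plus_grassmann :: "'a grassmann \<Rightarrow> 'a grassmann \<Rightarrow> 'a grassmann" is "(+)" .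
lift_definition minus_grassmann :: "'a grassmann \<Rightarrow> 'a grassmann \<Rightarrow> 'a grassmann" is "(-)" .
lift_definition uminus_grassmann :: "'a grassmann \<Rightarrow> 'a grassmann" is "uminus" .
lift_definition times_grassmann :: "'a grassmann \<Rightarrow> 'a grassmann \<Rightarrow> 'a grassmann"
  is coords_mult .

instance
proof
  fix a b c :: "'a grassmann"
  show "a + b + c = a + (b + c)" by transfer (simp add: add.assoc)
  show "a + b = b + a" by transfer (simp add: add.commute)
  show "0 + a = a" by transfer simp
  show "- a + a = 0" by transfer simp
  show "a - b = a + - b" by transfer simp
  show "a * b * c = a * (b * c)" by transfer (rule coords_mult_assoc)
  show "1 * a = a" by transfer (rule coords_mult_one)
  show "a * 1 = a" by transfer (rule coords_mult_one)
  show "(a + b) * c = a * c + b * c" by transfer (rule coords_mult_add_left)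
  show "a * (b + c) = a * b + a * c" by transfer (rule coords_mult_add_right)
  show "(0::'a grassmann) \<noteq> 1"
    by transfer (metis lookup_single_eq lookup_zero zero_neq_one)
qed

end

lift_definition gscale :: "'a::comm_ring_1 \<Rightarrow> 'a grassmann \<Rightarrow> 'a grassmann"
  is "\<lambda>c. Poly_Mapping.map ((*) c)" .

lift_definition gmon :: "nat fset \<Rightarrow> 'a::comm_ring_1 grassmann"
  is "\<lambda>S. Poly_Mapping.single S 1" .

text \<open>
  For \<open>i \<ge> 1\<close>, \<open>gen i\<close> is the generator \<open>e\<^sub>i\<close>. The next two lemmas confirm the defining
  relations and that the ordered monomials in the generators are the chosen basis.
\<close>

definition gen :: "nat \<Rightarrow> 'a::comm_ring_1 grassmann" where
  "gen i = gmon {|i - 1|}"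

lemma gen_anticommute:
  assumes "i \<ge> 1" "j \<ge> 1"
  shows "gen i * gen j + gen j * gen i = (0 :: 'a::comm_ring_1 grassmann)"
proof -
  have *: "{(i, j). i = a \<and> j = b \<and> j < i} = (if b < a then {(a, b)} else {})" for a b :: nat
    by auto
  have "mon_sign {|a|} {|b|} + mon_sign {|b|} {|a|} = (0 :: 'a)" for a b
    by (cases a b rule: linorder_cases) (auto simp: mon_sign_def *)
  then show ?thesis unfolding gen_def
    by transfer (simp add: coords_mult_single single_add[symmetric] sup_commute)
qed

lemma prod_gens_eq_gmon:
  assumes "sorted_wrt (<) is" "\<forall>i\<in>set is. i \<ge> 1"
  shows "prod_list (map gen is) =
    (gmon (fset_of_list (map (\<lambda>i. i - 1) is)) :: 'a::comm_ring_1 grassmann)"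
  using assms
proof (induction "is")
  case Nil
  show ?case by simp (transfer, simp)
next
  case (Cons i "is")
  let ?T = "fset_of_list (map (\<lambda>i. i - 1) is)"
  have lt: "i - 1 < j" if "j |\<in>| ?T" for j
    using that Cons.prems by (auto simp: fset_of_list_elem) (metis diff_less_mono)
  have 0: "{(a, b). a |\<in>| {|i - 1|} \<and> b |\<in>| ?T \<and> b < a} = {}"
    using lt by fastforce
  have "{|i - 1|} |\<inter>| ?T = {||}" using lt by fastforce
  with 0 have "mon_sign {|i - 1|} ?T = (1 :: 'a)"
    unfolding mon_sign_def by (simp only: card.empty power_0 simp_thms if_True)
  then have "(gmon {|i - 1|} :: 'a grassmann) * gmon ?T = gmon ({|i - 1|} |\<union>| ?T)"
    by transfer (simp only: coords_mult_single mult_1)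
  then show ?case using Cons by (simp add: gen_def)
qed

subsection \<open>The gradings\<close>

datatype grading = E_star nat | E_infty | E_fin nat

text \<open>
  \<open>E_star k\<close>, \<open>E_infty\<close> and \<open>E_fin k\<close> are the gradings of \<open>E\<^bsub>k*\<^esub>\<close>, \<open>E\<^sub>\<infinity>\<close> and \<open>E\<^sub>k\<close>;
  \<open>gen_degree d i\<close> is the degree of \<open>e\<^sub>i\<close>, for \<open>i \<ge> 1\<close>.
\<close>

fun gen_degree :: "grading \<Rightarrow> nat \<Rightarrow> bit" where
  "gen_degree (E_star k) i = (if i \<le> k then 1 else 0)"
| "gen_degree E_infty i = (if odd i then 1 else 0)"
| "gen_degree (E_fin k) i = (if i \<le> k then 0 else 1)"

definition mon_degree :: "grading \<Rightarrow> nat fset \<Rightarrow> bit" where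
  "mon_degree d S = (\<Sum>j\<in>fset S. gen_degree d (Suc j))"

definition homogeneous_part :: "grading \<Rightarrow> bit \<Rightarrow> 'a::comm_ring_1 grassmann set" where
  "homogeneous_part d g = {x. \<forall>S\<in>Poly_Mapping.keys (coords x). mon_degree d S = g}"

section \<open>The free algebra and its graded identities\<close>

datatype 'v free_monoid = Word (letters: "'v list")

instantiation free_monoid :: (type) monoid_add
begin

definition zero_free_monoid :: "'a free_monoid" where "0 = Word []"

definition plus_free_monoid :: "'a free_monoid \<Rightarrow> 'a free_monoid \<Rightarrow> 'a free_monoid" where
  "u + v = Word (letters u @ letters v)"

instance
  by standard (simp_all add: zero_free_monoid_def plus_free_monoid_def)

end

text \<open>
  With concatenation as the (additively written) operation on words, the convolution
  product of \<^theory>\<open>HOL-Library.Poly_Mapping\<close> is the product of the free associative algebra.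
\<close>

type_synonym ('v, 'a) free_algebra = "'v free_monoid \<Rightarrow>\<^sub>0 'a"

datatype var = Y nat | Z nat

fun var_degree :: "var \<Rightarrow> bit" where
  "var_degree (Y i) = 0"
| "var_degree (Z i) = 1"

definition subst ::
  "('v \<Rightarrow> 'a grassmann) \<Rightarrow> ('v, 'a::comm_ring_1) free_algebra \<Rightarrow> 'a grassmann" where
  "subst \<phi> f = (\<Sum>w\<in>Poly_Mapping.keys f.
     gscale (Poly_Mapping.lookup f w) (prod_list (map \<phi> (letters w))))"

definition graded_identities :: "grading \<Rightarrow> (var, 'a::comm_ring_1) free_algebra set" where
  "graded_identities d =
     {f. \<forall>\<phi>. (\<forall>v. \<phi> v \<in> homogeneous_part d (var_degree v)) \<longrightarrow> subst \<phi> f = 0}"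

definition free_algebra_on :: "'v set \<Rightarrow> ('v, 'a::comm_ring_1) free_algebra ring" where
  "free_algebra_on X =
     \<lparr>carrier = {f. \<forall>w\<in>Poly_Mapping.keys f. set (letters w) \<subseteq> X},
      mult = (*), one = 1, zero = 0, add = (+)\<rparr>"

definition vars :: "nat \<Rightarrow> var set" where
  "vars m = Y ` {1..m} \<union> Z ` {1..m}"

text \<open>
  The base field inside a quotient of the free algebra, that is, the cosets of the
  constant polynomials; the \<open>F\<close>-vector space structure of the quotient is multiplication by
  these cosets.
\<close>

definition scalars :: "'v set \<Rightarrow> ('v, 'a::comm_ring_1) free_algebra set
    \<Rightarrow> ('v, 'a) free_algebra set set" where
  "scalars X I = range (\<lambda>c. I +>\<^bsub>free_algebra_on X\<^esub> Poly_Mapping.single 0 c)"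

section \<open>Gelfand-Kirillov dimension\<close>

text \<open>
  Here \<open>A\<close> is a ring containing the field \<open>K\<close>. In \<^theory>\<open>HOL-Algebra.Embedded_Algebras\<close> the
  predicate \<^const>\<open>subalgebra\<close> says that \<open>W\<close> is a \<open>K\<close>-subspace of \<open>A\<close>. Thus \<open>power_space A K V n\<close> is
  \<open>K + V + V\<^sup>2 + \<cdots> + V\<^sup>n\<close>. The supremum ranges over all finite-dimensional subspaces \<open>V\<close>; for a
  finitely generated \<open>A\<close> it is attained at every finite-dimensional generating subspace.
\<close>

definition power_space :: "('a, 'b) ring_scheme \<Rightarrow> 'a set \<Rightarrow> 'a set \<Rightarrow> nat \<Rightarrow> 'a set" where
  "power_space A K V n =
     \<Inter>{W. subalgebra K W A \<and>
          {foldr (\<otimes>\<^bsub>A\<^esub>) vs \<one>\<^bsub>A\<^esub> | vs. set vs \<subseteq> V \<and> length vs \<le> n} \<subseteq> W}"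

definition growth :: "('a, 'b) ring_scheme \<Rightarrow> 'a set \<Rightarrow> 'a set \<Rightarrow> nat \<Rightarrow> nat" where
  "growth A K V n = ring.dim A K (power_space A K V n)"

definition GK_dim :: "('a, 'b) ring_scheme \<Rightarrow> 'a set \<Rightarrow> ereal" where
  "GK_dim A K =
     (SUP V\<in>{V. ring.finite_dimension A K V}.
        limsup (\<lambda>n. ereal (log (real n) (real (growth A K V n)))))"

end

theory Submission
  imports Defs "HOL-Computational_Algebra.Polynomial" "HOL-Real_Asymp.Real_Asymp"
begin

text \<open>
  Every element of \<open>E\<close> is a scalar plus an element of the augmentation ideal, and in
  characteristic \<open>p > 2\<close> the latter elements are nilpotent in a uniform way. Split such an element
  into the parts spanned by monomials of even and of odd length. These parts commute with each
  other up to a sign, the odd part squares to zero, and the even part has \<open>p\<close>-th power zero because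
  it is a sum of commuting elements of square zero
  (\<open>parity_part_power_CHAR\<close>). By the pigeonhole principle, a product formed from the nilpotent
  parts of \<open>r\<close> given elements vanishes as soon as it has more than \<open>2 r (p - 1)\<close> factors
  (\<open>nil_part_words_vanish\<close>).

  Upper bound. Let \<open>\<phi>\<close> be a graded substitution. Expanding \<open>\<phi> v = a\<^sub>v + n\<^sub>v\<close>, the value of a word of
  length at most \<open>L\<close> is a combination, with coefficients that do not depend on \<open>\<phi>\<close>, of terms
  \<open>a\<^sup>\<alpha> n\<^sub>u\<close> where \<open>u\<close> is a word of bounded length and every exponent in \<open>\<alpha>\<close> is at most \<open>L\<close>. The
  odd variables have \<open>a\<^sub>v = 0\<close>, as scalars have degree \<open>0\<close>, so \<open>\<alpha>\<close> has only \<open>m\<close> entries and there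
  are at most \<open>C (L + 1)\<^sup>m\<close> terms (\<open>card_index\<close>). More elements of degree at most \<open>L\<close> than
  this are linearly dependent modulo the identities (\<open>subst_linearly_dependent\<close>).
  If \<open>V\<close> is a finite-dimensional subspace of \<open>A\<close>, represented in degrees at most \<open>N\<close>, then the
  products of \<open>n\<close> elements of \<open>V\<close> lie in degrees at most \<open>n N\<close>, and the growth is at most \<open>C (n N + 1)\<^sup>m\<close>
  (\<open>growth_le\<close>).

  Lower bound. Scalars are legitimate values for the even variables, so an identity in the
  monomials \<open>y\<^sub>1\<^bsup>\<alpha>\<^sub>1\<^esup> \<cdots> y\<^sub>m\<^bsup>\<alpha>\<^sub>m\<^esup>\<close> is a polynomial function on \<open>F\<^sup>m\<close> that vanishes, hence it has zero
  coefficients because \<open>F\<close> is infinite. There are at least \<open>(n / m)\<^sup>m\<close> such monomials of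
  degree at most \<open>n\<close> (\<open>growth_generator_space_ge\<close>). Both bounds have logarithmic growth rate \<open>m\<close>.
\<close>

section \<open>Scalars and parity in the Grassmann algebra\<close>

lemma lookup_gscale [simp]:
  "Poly_Mapping.lookup (coords (gscale c x)) S = c * Poly_Mapping.lookup (coords x) S"
  by (simp add: gscale.rep_eq Poly_Mapping.map.rep_eq when_def)

lemma grassmann_eqI:
  assumes "\<And>S. Poly_Mapping.lookup (coords x) S = Poly_Mapping.lookup (coords y) S"
  shows "x = y"
  using assms by (metis coords_inject poly_mapping_eqI)

lemma coords_sum: "coords (\<Sum>i\<in>A. f i) = (\<Sum>i\<in>A. coords (f i))"
  by (induction A rule: infinite_finite_induct)
    (simp_all add: zero_grassmann.rep_eq plus_grassmann.rep_eq)

lemmas coords_simps = zero_grassmann.rep_eq one_grassmann.rep_eq plus_grassmann.rep_eq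
  minus_grassmann.rep_eq uminus_grassmann.rep_eq lookup_add lookup_minus lookup_uminus gmon.rep_eq

lemma gscale_linear [simp]:
  "gscale c (x + y) = gscale c x + gscale c y"
  "gscale c (x - y) = gscale c x - gscale c y"
  "gscale (a + b) x = gscale a x + gscale b x"
  "gscale a (gscale b x) = gscale (a * b) x"
  "gscale c 0 = 0" "gscale 0 x = 0" "gscale 1 x = x"
  by (rule grassmann_eqI; simp add: coords_simps algebra_simps)+

lemma gscale_sum: "gscale c (\<Sum>i\<in>A. f i) = (\<Sum>i\<in>A. gscale c (f i))"
  by (induction A rule: infinite_finite_induct) simp_all

lemma gscale_sum_left: "gscale (\<Sum>i\<in>A. c i) x = (\<Sum>i\<in>A. gscale (c i) x)"
  by (induction A rule: infinite_finite_induct) simp_all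

lemma gscale_gmon_mult:
  "gscale a (gmon S) * gscale b (gmon T) = gscale (mon_sign S T * a * b) (gmon (S |\<union>| T))"
proof -
  have single: "coords (gscale c (gmon U)) = Poly_Mapping.single U c" for c :: 'a and U
    by (rule poly_mapping_eqI) (simp add: gmon.rep_eq lookup_single when_def)
  show ?thesis
    by (rule injD[of coords]) (simp_all add: inj_on_def coords_inject times_grassmann.rep_eq single
        coords_mult_single)
qed

lemma grassmann_expansion:
  "x = (\<Sum>S\<in>Poly_Mapping.keys (coords x). gscale (Poly_Mapping.lookup (coords x) S) (gmon S))"
  by (rule grassmann_eqI)
    (auto simp: coords_sum lookup_sum gmon.rep_eq lookup_single when_def in_keys_iff
      if_distrib[of "\<lambda>z. _ * z"] cong: if_cong)

lemma gscale_mult: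
  "gscale c x * y = gscale c (x * y)" "x * gscale c y = gscale c (x * y)"
proof -
  let ?l = "\<lambda>x. Poly_Mapping.lookup (coords x)" and ?k = "\<lambda>x. Poly_Mapping.keys (coords x)"
  have "gscale c x * y =
      (\<Sum>S\<in>?k x. gscale (c * ?l x S) (gmon S)) * (\<Sum>T\<in>?k y. gscale (?l y T) (gmon T))"
    by (subst grassmann_expansion[of x], subst grassmann_expansion[of y]) (simp add: gscale_sum)
  also have "\<dots> =
    gscale c ((\<Sum>S\<in>?k x. gscale (?l x S) (gmon S)) * (\<Sum>T\<in>?k y. gscale (?l y T) (gmon T)))"
    by (simp add: sum_product gscale_gmon_mult gscale_sum ac_simps)
  finally show "gscale c x * y = gscale c (x * y)" by (simp flip: grassmann_expansion)
  have "x * gscale c y =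
      (\<Sum>S\<in>?k x. gscale (?l x S) (gmon S)) * (\<Sum>T\<in>?k y. gscale (c * ?l y T) (gmon T))"
    by (subst grassmann_expansion[of x], subst grassmann_expansion[of y]) (simp add: gscale_sum)
  also have "\<dots> =
    gscale c ((\<Sum>S\<in>?k x. gscale (?l x S) (gmon S)) * (\<Sum>T\<in>?k y. gscale (?l y T) (gmon T)))"
    by (simp add: sum_product gscale_gmon_mult gscale_sum ac_simps)
  finally show "x * gscale c y = gscale c (x * y)" by (simp flip: grassmann_expansion)
qed

lemma of_nat_mult_eq_gscale: "of_nat n * x = gscale (of_nat n) x"
  by (induction n) (simp_all add: distrib_right)

definition scalar_part :: "'a::comm_ring_1 grassmann \<Rightarrow> 'a" where
  "scalar_part x = Poly_Mapping.lookup (coords x) {||}"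

text \<open>
  In the decomposition of \<open>x\<close> along \<open>E = F \<oplus> J\<close>, where the augmentation ideal \<open>J\<close> is spanned by
  the nonempty monomials, the scalar part and this are the two components.
\<close>

definition nil_part :: "'a::comm_ring_1 grassmann \<Rightarrow> 'a grassmann" where
  "nil_part x = x - gscale (scalar_part x) 1"

lemma scalar_part_nil_part: "scalar_part (nil_part x) = 0"
  by (simp add: nil_part_def scalar_part_def coords_simps)

text \<open>
  This is the grading of \<open>E\<close> by the length of the monomials modulo 2, not by the degrees of the
  generators: commutation in \<open>E\<close> up to sign is governed by the lengths.
\<close>

definition parity_part :: "bool \<Rightarrow> 'a::comm_ring_1 grassmann \<Rightarrow> 'a grassmann" where
  "parity_part b x =
     (\<Sum>S | S \<in> Poly_Mapping.keys (coords x) \<and> even (fcard S) = b.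
        gscale (Poly_Mapping.lookup (coords x) S) (gmon S))"

lemma parity_decomposition: "x = parity_part True x + parity_part False x"
proof -
  let ?K = "Poly_Mapping.keys (coords x)"
  have "?K = {S \<in> ?K. even (fcard S) = True} \<union> {S \<in> ?K. even (fcard S) = False}" by auto
  then show ?thesis
    unfolding parity_part_def
    by (subst grassmann_expansion[of x], subst (1) \<open>?K = _\<close>, subst sum.union_disjoint) auto
qed

text \<open>
  For disjoint \<open>S\<close> and \<open>T\<close>, each pair in \<open>S \<times> T\<close> is an inversion for exactly one of the orders
  \<open>ST\<close> and \<open>TS\<close>, so the two numbers of inversions add up to \<open>|S| |T|\<close>.
\<close>

lemma mon_sign_commute:
  "mon_sign S T = ((- 1) ^ (fcard S * fcard T) * mon_sign T S :: 'a::comm_ring_1)"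
proof (cases "S |\<inter>| T = {||}")
  case True
  define iv where "iv A B = {(i, j). i |\<in>| A \<and> j |\<in>| B \<and> j < (i::nat)}" for A B
  have fin: "finite (iv A B)" for A B
    by (rule finite_subset[of _ "fset A \<times> fset B"]) (auto simp: iv_def)
  have "fset S \<times> fset T = iv S T \<union> prod.swap ` iv T S"
    using True by (auto simp: iv_def image_iff)
  moreover have "card (prod.swap ` iv T S) = card (iv T S)"
    by (rule card_image) (auto intro!: inj_onI)
  moreover have "card (iv S T \<union> prod.swap ` iv T S) = card (iv S T) + card (prod.swap ` iv T S)"
    by (intro card_Un_disjoint finite_imageI fin) (auto simp: iv_def)
  ultimately have "fcard S * fcard T = card (iv S T) + card (iv T S)"
    by (metis card_cartesian_product fcard.rep_eq)
  moreover have "(- 1) ^ (a + b + b) = ((- 1) ^ a :: 'a)" for a b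
    by (simp add: power_add mult.assoc flip: power_mult_distrib)
  ultimately show ?thesis
    using True by (simp add: mon_sign_def iv_def inf_commute flip: power_add)
qed (simp add: mon_sign_def inf_commute)

lemma parity_part_commute:
  "parity_part b x * parity_part c y =
     (if b \<or> c then 1 else - 1) * (parity_part c y * parity_part b x)"
proof -
  let ?K = "\<lambda>b x. {S \<in> Poly_Mapping.keys (coords x). even (fcard S) = b}"
  let ?t = "\<lambda>x S. gscale (Poly_Mapping.lookup (coords x) S) (gmon S)"
  let ?s = "if b \<or> c then 1 else - 1 :: 'a grassmann"
  have swap: "?t x S * ?t y T = ?s * (?t y T * ?t x S)" if "S \<in> ?K b x" "T \<in> ?K c y" for S T
  proof -
    have "(- 1) ^ (fcard S * fcard T) = (if b \<or> c then 1 else - 1 :: 'a)"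
      using that by auto
    then have "mon_sign S T = (if b \<or> c then 1 else - 1) * (mon_sign T S :: 'a)"
      using mon_sign_commute[of S T, where 'a='a] by simp
    moreover have "gscale (- a) z = - gscale a z" for a :: 'a and z
      by (rule grassmann_eqI) (simp add: coords_simps)
    ultimately show ?thesis
      by (simp add: gscale_gmon_mult sup_commute ac_simps)
  qed
  have "parity_part b x * parity_part c y = (\<Sum>S\<in>?K b x. \<Sum>T\<in>?K c y. ?t x S * ?t y T)"
    by (simp add: parity_part_def sum_product)
  also have "\<dots> = (\<Sum>S\<in>?K b x. \<Sum>T\<in>?K c y. ?s * (?t y T * ?t x S))"
    using swap by (intro sum.cong refl) blast
  also have "\<dots> = (\<Sum>T\<in>?K c y. \<Sum>S\<in>?K b x. ?s * (?t y T * ?t x S))"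
    by (rule sum.swap)
  also have "\<dots> = ?s * (parity_part c y * parity_part b x)"
    unfolding parity_part_def sum_product by (simp only: sum_distrib_left)
  finally show ?thesis .
qed

lemma parity_part_commute_up_to_sign:
  "parity_part b x * parity_part c y = parity_part c y * parity_part b x \<or>
   parity_part b x * parity_part c y = - (parity_part c y * parity_part b x)"
  using parity_part_commute[of b x c y] by (cases "b \<or> c") simp_all

section \<open>Uniform nilpotency of the augmentation ideal\<close>

text \<open>
  The binomial theorem without its terms containing \<open>y\<^sup>2\<close>. With \<open>n\<close> the characteristic the
  second summand vanishes too, so adding such a \<open>y\<close> does not change an \<open>n\<close>-th power.
\<close>

lemma power_add_square_zero:
  fixes x y :: "'b::ring_1"
  assumes "x * y = y * x" "y * y = 0"
  shows "(x + y) ^ n = x ^ n + of_nat n * (x ^ (n - 1) * y)"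
proof (induction n)
  case (Suc n)
  have "y * x ^ k = x ^ k * y" for k
    by (rule power_commuting_commutes[OF assms(1), symmetric])
  then have *: "x ^ k * y * x = x ^ Suc k * y" "x ^ k * y * y = 0" for k
    by (simp_all add: mult.assoc assms) (metis assms(1) mult.assoc power_commutes)
  have "(x + y) ^ Suc n = (x ^ n + of_nat n * (x ^ (n - 1) * y)) * (x + y)"
    by (simp only: power_Suc2 Suc)
  also have "\<dots> = x ^ Suc n + x ^ n * y + of_nat n * (x ^ Suc (n - 1) * y)"
    using * by (simp add: distrib_left distrib_right mult.assoc power_commutes
        flip: power_Suc2)
  also have "\<dots> = x ^ Suc n + of_nat (Suc n) * (x ^ n * y)"
    by (cases n) (simp_all add: distrib_right)
  finally show ?case by simp
qed simp


lemma even_sum_power_CHAR: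
  fixes c :: "nat fset \<Rightarrow> 'a::comm_ring_1"
  assumes "finite A" "\<And>S. S \<in> A \<Longrightarrow> even (fcard S) \<and> S \<noteq> {||}" "CHAR('a) > 0"
  shows "(\<Sum>S\<in>A. gscale (c S) (gmon S)) ^ CHAR('a) = 0"
  using assms(1,2)
proof (induction A)
  case empty
  then show ?case using assms(3) by (simp add: power_0_left)
next
  case (insert S A)
  let ?t = "\<lambda>S. gscale (c S) (gmon S)"
  have "?t T * ?t S = ?t S * ?t T" if "T \<in> A" for T
    using insert.prems[of S] mon_sign_commute[of S T, where 'a='a]
    by (simp add: gscale_gmon_mult sup_commute ac_simps)
  then have "(\<Sum>T\<in>A. ?t T) * ?t S = ?t S * (\<Sum>T\<in>A. ?t T)"
    by (simp add: sum_distrib_left sum_distrib_right)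
  moreover have "?t S * ?t S = 0"
    using insert.prems[of S] by (simp add: gscale_gmon_mult mon_sign_def)
  ultimately have "((\<Sum>T\<in>A. ?t T) + ?t S) ^ CHAR('a) = (\<Sum>T\<in>A. ?t T) ^ CHAR('a)"
    by (subst power_add_square_zero) (simp_all add: of_nat_mult_eq_gscale)
  then show ?case using insert by (simp add: add.commute)
qed

text \<open>
  For the even part the powers are computed by adding one monomial at a time; all monomials
  involved are nonempty, so they square to zero. The odd part anticommutes with itself, whence
  \<open>2 z = 0\<close> for its square \<open>z\<close>, and \<open>2\<close> is invertible.
\<close>

lemma parity_part_power_CHAR:
  fixes x :: "'a::field grassmann"
  assumes "CHAR('a) > 2" "scalar_part x = 0"
  shows "parity_part b x ^ CHAR('a) = 0"
proof (cases b)
  case True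
  have "{||} \<notin> Poly_Mapping.keys (coords x)"
    using assms(2) by (simp add: scalar_part_def in_keys_iff)
  with True assms(1) show ?thesis
    unfolding parity_part_def by (intro even_sum_power_CHAR) auto
next
  case False
  let ?z = "parity_part b x * parity_part b x"
  have "?z = - ?z" using parity_part_commute[of b x b x] False by simp
  have "?z = 0"
  proof (rule grassmann_eqI)
    fix S
    have "(2::'a) \<noteq> 0"
      using of_nat_eq_0_iff_char_dvd[of 2, where 'a='a] assms(1) by (auto dest: dvd_imp_le)
    moreover have "Poly_Mapping.lookup (coords ?z) S = - Poly_Mapping.lookup (coords ?z) S"
      by (subst \<open>?z = - ?z\<close>) (simp add: coords_simps)
    then have "2 * Poly_Mapping.lookup (coords ?z) S = 0" by simp
    ultimately show "Poly_Mapping.lookup (coords ?z) S = Poly_Mapping.lookup (coords 0) S"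
      by (simp add: coords_simps)
  qed
  moreover have e: "2 + (CHAR('a) - 2) = CHAR('a)" using assms(1) by simp
  have "parity_part b x ^ CHAR('a) = ?z * parity_part b x ^ (CHAR('a) - 2)"
    using power_add[of "parity_part b x" 2 "CHAR('a) - 2"]
    unfolding power2_eq_square e .
  ultimately show ?thesis by simp
qed

text \<open>
  All occurrences of one letter can be moved to the front, at the price of a sign that goes into
  the cofactor \<open>r\<close>.
\<close>

lemma prod_list_count_factor:
  fixes f :: "'h \<Rightarrow> 'b::ring_1"
  assumes "\<And>x y. f x * f y = f y * f x \<or> f x * f y = - (f y * f x)"
  shows "\<exists>r. prod_list (map f w) = f h ^ count_list w h * r"
proof (induction w)
  case (Cons x w)
  then obtain r where r: "prod_list (map f w) = f h ^ count_list w h * r" by blast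
  have "f x * f h ^ n = f h ^ n * f x \<or> f x * f h ^ n = f h ^ n * (- f x)" for n
  proof (induction n)
    case (Suc n)
    have 1: "f x * f h ^ Suc n = (f x * f h ^ n) * f h"
      by (simp add: mult.assoc power_commutes)
    have 2: "f h ^ Suc n * y = f h ^ n * (f h * y)" for y
      by (simp only: power_Suc2 mult.assoc)
    have 3: "f h ^ n * y * f h = f h ^ n * (y * f h)" for y
      by (rule mult.assoc)
    show ?case using Suc assms[of x h] unfolding 1 2 by (auto simp: 3)
  qed simp
  then have "\<exists>r'. f x * f h ^ count_list w h = f h ^ count_list w h * r'" by blast
  then obtain r' where r': "f x * f h ^ count_list w h = f h ^ count_list w h * r'" by blast
  show ?case
  proof (cases "x = h")
    case True
    then show ?thesis using r by (intro exI[of _ r]) (simp add: mult.assoc)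
  next
    case False
    have "prod_list (map f (x # w)) = (f x * f h ^ count_list w h) * r"
      by (simp add: r mult.assoc)
    then show ?thesis using False by (intro exI[of _ "r' * r"]) (simp add: r' mult.assoc)
  qed
qed simp

text \<open>
  Some letter occurs more than \<open>q\<close> times by the pigeonhole principle, and its occurrences can be
  collected.
\<close>

lemma long_words_vanish:
  fixes f :: "'h \<Rightarrow> 'b::ring_1"
  assumes "\<And>x y. f x * f y = f y * f x \<or> f x * f y = - (f y * f x)"
    and "\<And>x. f x ^ Suc q = 0"
    and "finite H" "set w \<subseteq> H" "length w > card H * q"
  shows "prod_list (map f w) = 0"
proof -
  have "\<exists>h\<in>H. count_list w h > q"
  proof (rule ccontr)
    assume "\<not> ?thesis"
    then have "(\<Sum>h\<in>H. count_list w h) \<le> card H * q"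
      using sum_bounded_above[of H "count_list w" q] by (auto simp: not_less)
    moreover have "(\<Sum>h\<in>H. count_list w h) = (\<Sum>h\<in>set w. count_list w h)"
      using assms(3,4) by (intro sum.mono_neutral_right) (auto simp: count_list_0_iff)
    ultimately show False using assms(5) sum_count_set[of w "set w"] by simp
  qed
  then obtain h where h: "count_list w h > q" by blast
  obtain r where "prod_list (map f w) = f h ^ count_list w h * r"
    using prod_list_count_factor[of f, OF assms(1)] by blast
  moreover have "f h ^ count_list w h = 0"
    using power_add[of "f h" "Suc q" "count_list w h - Suc q"] h assms(2)[of h] by simp
  ultimately show ?thesis by simp
qed

text \<open>
  Multiplying out a product of binomials. The left factor \<open>u\<close> collects the choices already made
  in the induction.
\<close>

lemma prod_list_of_sums_vanishes:
  fixes f :: "'v \<times> bool \<Rightarrow> 'b::ring_1"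
  assumes "\<And>v. map fst v = w \<Longrightarrow> u * prod_list (map f v) = 0"
  shows "u * prod_list (map (\<lambda>x. f (x, True) + f (x, False)) w) = 0"
  using assms
proof (induction w arbitrary: u)
  case (Cons x w)
  have "u * f (x, b) * prod_list (map (\<lambda>x. f (x, True) + f (x, False)) w) = 0" for b
    using Cons.prems[of "(x, b) # _"] by (intro Cons.IH) (simp add: mult.assoc)
  then show ?case by (simp add: distrib_left distrib_right flip: mult.assoc)
qed simp

text \<open>
  Each variable contributes two letters, the even and the odd part of its nilpotent part, so the
  pigeonhole bound is taken over \<open>2 |X|\<close> letters.
\<close>

lemma nil_part_words_vanish:
  fixes \<phi> :: "'v \<Rightarrow> 'a::field grassmann"
  assumes "CHAR('a) > 2" "finite X" "set w \<subseteq> X" "length w > 2 * card X * (CHAR('a) - 1)"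
  shows "prod_list (map (\<lambda>v. nil_part (\<phi> v)) w) = 0"
proof -
  let ?f = "\<lambda>(v, b). parity_part b (nil_part (\<phi> v))"
  have "prod_list (map ?f v) = 0" if "map fst v = w" for v
  proof (rule long_words_vanish[where H = "X \<times> UNIV" and q = "CHAR('a) - 1"])
    show "?f x * ?f y = ?f y * ?f x \<or> ?f x * ?f y = - (?f y * ?f x)" for x y
      by (cases x; cases y) (simp only: prod.case parity_part_commute_up_to_sign)
    show "?f x ^ Suc (CHAR('a) - 1) = 0" for x
      using parity_part_power_CHAR[OF assms(1) scalar_part_nil_part] assms(1)
      by (auto split: prod.splits)
    show "set v \<subseteq> X \<times> UNIV" using that assms(3) by force
    show "card (X \<times> (UNIV :: bool set)) * (CHAR('a) - 1) < length v"
      using assms(4) that by (auto simp: card_cartesian_product)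
  qed (use assms(2) in simp)
  then show ?thesis
    using prod_list_of_sums_vanishes[of w 1 ?f] by (simp flip: parity_decomposition)
qed

section \<open>Solving linear systems\<close>

text \<open>
  Gaussian elimination: an equation in which some unknown \<open>j\<close> occurs is solved for that unknown,
  which leaves one equation and one unknown less.
\<close>

lemma underdetermined_system:
  fixes a :: "'i \<Rightarrow> 'b \<Rightarrow> 'f::field"
  assumes "finite B" "finite I" "card B < card I"
  shows "\<exists>c. (\<exists>i\<in>I. c i \<noteq> 0) \<and> (\<forall>b\<in>B. (\<Sum>i\<in>I. c i * a i b) = 0)"
  using assms
proof (induction B arbitrary: I a)
  case empty
  then have "I \<noteq> {}" by auto
  then show ?case by (intro exI[of _ "\<lambda>_. 1"]) auto
next
  case (insert b B)
  show ?case
  proof (cases "\<forall>i\<in>I. a i b = 0")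
    case True
    then show ?thesis using insert.IH[of I a] insert.prems insert.hyps by (auto simp: True)
  next
    case False
    then obtain j where j: "j \<in> I" "a j b \<noteq> 0" by blast
    \<comment> \<open>a multiple of equation \<open>b\<close> subtracted from equation \<open>b'\<close> removes the unknown \<open>j\<close>\<close>
    define a' where "a' i b' = a i b' - a i b / a j b * a j b'" for i b'
    obtain c where c: "\<exists>i\<in>I - {j}. c i \<noteq> 0"
      "\<And>b'. b' \<in> B \<Longrightarrow> (\<Sum>i\<in>I - {j}. c i * a' i b') = 0"
      using insert.IH[of "I - {j}" a'] insert.prems insert.hyps j
      by (fastforce simp: card_Diff_singleton)
    \<comment> \<open>back substitution: this value of the unknown \<open>j\<close> solves equation \<open>b\<close>\<close>
    define c' where "c' = c(j := - (\<Sum>i\<in>I - {j}. c i * (a i b / a j b)))"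
    have "(\<Sum>i\<in>I. c' i * a i b') = 0" if "b' \<in> insert b B" for b'
    proof -
      have "(\<Sum>i\<in>I. c' i * a i b') = c' j * a j b' + (\<Sum>i\<in>I - {j}. c' i * a i b')"
        using insert.prems j by (simp add: sum.remove)
      also have "(\<Sum>i\<in>I - {j}. c' i * a i b') = (\<Sum>i\<in>I - {j}. c i * a i b')"
        by (rule sum.cong) (auto simp: c'_def)
      also have "c' j * a j b' + \<dots> = (\<Sum>i\<in>I - {j}. c i * a' i b')"
        by (simp add: c'_def a'_def sum_distrib_right sum_subtractf right_diff_distrib mult.assoc)
      also have "\<dots> = 0"
        using that c(2)[of b'] j by (cases "b' \<in> B") (auto simp: a'_def)
      finally show ?thesis .
    qed
    moreover have "\<exists>i\<in>I. c' i \<noteq> 0" using c(1) by (auto simp: c'_def)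
    ultimately show ?thesis by blast
  qed
qed

section \<open>Expanding words under substitutions\<close>

lemma subst_superset:
  assumes "finite W" "Poly_Mapping.keys f \<subseteq> W"
  shows "subst \<phi> f =
    (\<Sum>w\<in>W. gscale (Poly_Mapping.lookup f w) (prod_list (map \<phi> (letters w))))"
  unfolding subst_def using assms by (intro sum.mono_neutral_left) (auto simp: in_keys_iff)

lemma subst_add: "subst \<phi> (f + g) = subst \<phi> f + subst \<phi> g"
proof -
  let ?W = "Poly_Mapping.keys f \<union> Poly_Mapping.keys g"
  have "Poly_Mapping.keys (f + g) \<subseteq> ?W" by (rule Poly_Mapping.keys_add)
  then show ?thesis
    by (simp add: subst_superset[of ?W] lookup_add sum.distrib)
qed

lemma subst_single:
  "subst \<phi> (Poly_Mapping.single w c) = gscale c (prod_list (map \<phi> (letters w)))"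
  by (simp add: subst_superset[of "{w}"])

lemma subst_zero [simp]: "subst \<phi> 0 = 0"
  by (simp add: subst_def)

lemma subst_mult: "subst \<phi> (f * g) = subst \<phi> f * subst \<phi> g"
proof (induction f rule: poly_mapping_add_induct)
  case (single u a)
  show ?case
    by (induction g rule: poly_mapping_add_induct)
      (simp_all add: mult_single subst_single subst_add distrib_left gscale_mult
        plus_free_monoid_def mult.commute[of a])
qed (simp_all add: subst_add distrib_right)

lemma subst_uminus: "subst \<phi> (- f) = - subst \<phi> f"
  using subst_add[of \<phi> f "- f"] by (simp add: eq_neg_iff_add_eq_0 add.commute)

text \<open>
  The situation of the upper bound in abstract form: \<open>\<Phi>\<close> are the substitutions that are
  considered, \<open>X0\<close> contains the variables whose values may have a scalar part, and nilpotent
  parts of values multiply to zero in more than \<open>M\<close> factors.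
\<close>

locale word_expansion =
  fixes X0 X :: "'v set" and M :: nat and \<Phi> :: "('v \<Rightarrow> 'a::field grassmann) set"
  assumes finite_vars: "finite X"
    and vars_subset: "X0 \<subseteq> X"
    and scalar_part_vanishes: "\<And>\<phi> v. \<phi> \<in> \<Phi> \<Longrightarrow> v \<in> X - X0 \<Longrightarrow> scalar_part (\<phi> v) = 0"
    and nil_words_vanish: "\<And>\<phi> u. \<phi> \<in> \<Phi> \<Longrightarrow> set u \<subseteq> X \<Longrightarrow> length u > M \<Longrightarrow>
      prod_list (map (\<lambda>v. nil_part (\<phi> v)) u) = 0"
begin

text \<open>
  The pair \<open>(\<alpha>, u)\<close> stands for the term \<open>a\<^sup>\<alpha> n\<^sub>u\<close> in the scalar parts \<open>a\<close> and the nilpotent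
  parts \<open>n\<close> of the values of the variables.
\<close>

definition index :: "nat \<Rightarrow> (('v \<Rightarrow> nat) \<times> 'v list) set" where
  "index L = (X0 \<rightarrow>\<^sub>E {..L}) \<times> {u. set u \<subseteq> X \<and> length u \<le> M}"

definition term_value :: "('v \<Rightarrow> 'a grassmann) \<Rightarrow> ('v \<Rightarrow> nat) \<times> 'v list \<Rightarrow> 'a grassmann" where
  "term_value \<phi> b = gscale (\<Prod>v\<in>X0. scalar_part (\<phi> v) ^ fst b v)
     (prod_list (map (\<lambda>v. nil_part (\<phi> v)) (snd b)))"

text \<open>
  The order of the quantifiers is the point: the coefficients \<open>\<psi>\<close> serve all substitutions at
  once.
\<close>

definition expandable :: "nat \<Rightarrow> (('v \<Rightarrow> 'a grassmann) \<Rightarrow> 'a grassmann) \<Rightarrow> bool" where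
  "expandable L F \<longleftrightarrow>
     (\<exists>\<psi>. \<forall>\<phi>\<in>\<Phi>. F \<phi> = (\<Sum>b\<in>index L. gscale (\<psi> b) (term_value \<phi> b)))"

lemma finite_X0: "finite X0"
  using finite_vars vars_subset by (rule rev_finite_subset)

lemma finite_index: "finite (index L)"
  unfolding index_def using finite_vars finite_X0
  by (intro finite_cartesian_product finite_PiE finite_lists_length_le) auto

lemma card_index: "card (index L) = (L + 1) ^ card X0 * card {u. set u \<subseteq> X \<and> length u \<le> M}"
  unfolding index_def using finite_X0 by (simp add: card_cartesian_product card_PiE)

lemma expandable_cong:
  "expandable L F \<Longrightarrow> (\<And>\<phi>. \<phi> \<in> \<Phi> \<Longrightarrow> G \<phi> = F \<phi>) \<Longrightarrow> expandable L G"
  unfolding expandable_def by force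

lemma expandable_0: "expandable L (\<lambda>_. 0)"
  unfolding expandable_def by (rule exI[of _ "\<lambda>_. 0"]) simp

lemma expandable_add: "expandable L F \<Longrightarrow> expandable L G \<Longrightarrow> expandable L (\<lambda>\<phi>. F \<phi> + G \<phi>)"
proof -
  assume "expandable L F" "expandable L G"
  then obtain \<psi> \<psi>' where
    "\<forall>\<phi>\<in>\<Phi>. F \<phi> = (\<Sum>b\<in>index L. gscale (\<psi> b) (term_value \<phi> b))"
    "\<forall>\<phi>\<in>\<Phi>. G \<phi> = (\<Sum>b\<in>index L. gscale (\<psi>' b) (term_value \<phi> b))"
    unfolding expandable_def by blast
  then show ?thesis
    unfolding expandable_def by (intro exI[of _ "\<lambda>b. \<psi> b + \<psi>' b"]) (simp add: sum.distrib)
qed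

lemma expandable_gscale: "expandable L F \<Longrightarrow> expandable L (\<lambda>\<phi>. gscale c (F \<phi>))"
proof -
  assume "expandable L F"
  then obtain \<psi> where
    "\<forall>\<phi>\<in>\<Phi>. F \<phi> = (\<Sum>b\<in>index L. gscale (\<psi> b) (term_value \<phi> b))"
    unfolding expandable_def by blast
  then show ?thesis
    unfolding expandable_def by (intro exI[of _ "\<lambda>b. c * \<psi> b"]) (simp add: gscale_sum)
qed

lemma expandable_sum:
  "(\<And>i. i \<in> A \<Longrightarrow> expandable L (F i)) \<Longrightarrow> expandable L (\<lambda>\<phi>. \<Sum>i\<in>A. F i \<phi>)"
  by (induction A rule: infinite_finite_induct) (simp_all add: expandable_0 expandable_add)

lemma expandable_term: "b \<in> index L \<Longrightarrow> expandable L (\<lambda>\<phi>. term_value \<phi> b)"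
  unfolding expandable_def
  by (rule exI[of _ "\<lambda>b'. if b' = b then 1 else 0"])
    (simp add: finite_index if_distrib[of "\<lambda>c. gscale c _"] cong: if_cong)

text \<open>
  Writing \<open>\<phi> v = a\<^sub>v + n\<^sub>v\<close>, the scalar summand raises the exponent of \<open>v\<close> in \<open>\<alpha>\<close> (or vanishes)
  and the nilpotent summand puts \<open>v\<close> in front of \<open>u\<close> (or makes the word too long, and then the
  term vanishes). Only the scalar summand uses up one unit of the bound on exponents.
\<close>

lemma expandable_mult_variable:
  assumes "v \<in> X" "expandable L F"
  shows "expandable (Suc L) (\<lambda>\<phi>. \<phi> v * F \<phi>)"
proof -
  obtain \<psi> where \<psi>: "\<forall>\<phi>\<in>\<Phi>. F \<phi> = (\<Sum>b\<in>index L. gscale (\<psi> b) (term_value \<phi> b))"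
    using assms(2) unfolding expandable_def by blast
  have "expandable (Suc L) (\<lambda>\<phi>. \<phi> v * term_value \<phi> b)" if b: "b \<in> index L" for b
  proof -
    obtain \<alpha> u where bu: "b = (\<alpha>, u)" by (cases b)
    have \<alpha>: "\<alpha> \<in> X0 \<rightarrow>\<^sub>E {..L}" and u: "set u \<subseteq> X" "length u \<le> M"
      using b by (auto simp: bu index_def)
    have scal: "expandable (Suc L) (\<lambda>\<phi>. gscale (scalar_part (\<phi> v)) (term_value \<phi> b))"
    proof (cases "v \<in> X0")
      case True
      let ?b = "(\<alpha>(v := Suc (\<alpha> v)), u)"
      have "?b \<in> index (Suc L)"
        using \<alpha> u True by (fastforce simp: index_def PiE_iff extensional_def)
      then have "expandable (Suc L) (\<lambda>\<phi>. term_value \<phi> ?b)" by (rule expandable_term)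
      moreover have "term_value \<phi> ?b = gscale (scalar_part (\<phi> v)) (term_value \<phi> b)" for \<phi>
        using True finite_X0
        by (simp add: term_value_def bu prod.remove[of X0 v] mult.assoc)
      ultimately show ?thesis by simp
    next
      case False
      then show ?thesis
        using assms(1) scalar_part_vanishes by (intro expandable_cong[OF expandable_0]) simp
    qed
    have nil: "expandable (Suc L) (\<lambda>\<phi>. nil_part (\<phi> v) * term_value \<phi> b)"
    proof (cases "length u < M")
      case True
      have "(\<alpha>, v # u) \<in> index (Suc L)"
        using \<alpha> u True assms(1) by (force simp: index_def PiE_iff)
      from expandable_term[OF this] show ?thesis
        by (simp add: term_value_def bu gscale_mult)
    next
      case False
      have "nil_part (\<phi> v) * term_value \<phi> b = 0" if "\<phi> \<in> \<Phi>" for \<phi>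
        using nil_words_vanish[OF that, of "v # u"] u assms(1) False
        by (simp add: term_value_def bu gscale_mult)
      then show ?thesis by (intro expandable_cong[OF expandable_0])
    qed
    have split: "\<phi> v * x = gscale (scalar_part (\<phi> v)) x + nil_part (\<phi> v) * x" for \<phi> x
      by (simp add: nil_part_def left_diff_distrib gscale_mult)
    show ?thesis
      by (rule expandable_cong[OF expandable_add[OF scal nil]]) (rule split)
  qed
  then have "expandable (Suc L) (\<lambda>\<phi>. \<Sum>b\<in>index L. gscale (\<psi> b) (\<phi> v * term_value \<phi> b))"
    by (intro expandable_sum expandable_gscale)
  then show ?thesis
    by (rule expandable_cong) (simp add: \<psi> sum_distrib_left gscale_mult)
qed

lemma expandable_mono:
  assumes "expandable L F" "L \<le> L'"
  shows "expandable L' F"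
proof -
  obtain \<psi> where \<psi>: "\<forall>\<phi>\<in>\<Phi>. F \<phi> = (\<Sum>b\<in>index L. gscale (\<psi> b) (term_value \<phi> b))"
    using assms(1) unfolding expandable_def by blast
  have "index L \<subseteq> index L'" using assms(2) by (fastforce simp: index_def PiE_iff)
  then have "expandable L' (\<lambda>\<phi>. \<Sum>b\<in>index L. gscale (\<psi> b) (term_value \<phi> b))"
    by (intro expandable_sum expandable_gscale expandable_term) auto
  then show ?thesis by (rule expandable_cong) (simp add: \<psi>)
qed

lemma expandable_word:
  "set w \<subseteq> X \<Longrightarrow> expandable (length w) (\<lambda>\<phi>. prod_list (map \<phi> w))"
proof (induction w)
  case Nil
  have "(\<lambda>v\<in>X0. 0, []) \<in> index 0" by (auto simp: index_def)
  from expandable_term[OF this] show ?case by (simp add: term_value_def)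
next
  case (Cons v w)
  then show ?case using expandable_mult_variable[of v] by simp
qed

lemma expandable_subst:
  assumes "\<And>w. w \<in> Poly_Mapping.keys f \<Longrightarrow> set (letters w) \<subseteq> X \<and> length (letters w) \<le> L"
  shows "expandable L (\<lambda>\<phi>. subst \<phi> f)"
  unfolding subst_def using assms
  by (intro expandable_sum expandable_gscale expandable_mono[OF expandable_word]) auto

text \<open>
  The coefficients of the expansions form a homogeneous linear system with one equation for
  every term and one unknown for every element of \<open>J\<close>. Since they are independent of \<open>\<phi>\<close>, one
  solution works for all substitutions.
\<close>

lemma subst_linearly_dependent:
  fixes f :: "'i \<Rightarrow> ('v, 'a) free_algebra"
  assumes "\<And>i w. i \<in> J \<Longrightarrow> w \<in> Poly_Mapping.keys (f i) \<Longrightarrow>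
      set (letters w) \<subseteq> X \<and> length (letters w) \<le> L"
    and "finite J" "card (index L) < card J"
  shows "\<exists>c. (\<exists>i\<in>J. c i \<noteq> 0) \<and> (\<forall>\<phi>\<in>\<Phi>. (\<Sum>i\<in>J. gscale (c i) (subst \<phi> (f i))) = 0)"
proof -
  have "\<forall>i\<in>J. \<exists>\<psi>. \<forall>\<phi>\<in>\<Phi>. subst \<phi> (f i) = (\<Sum>b\<in>index L. gscale (\<psi> b) (term_value \<phi> b))"
    using assms(1) by (intro ballI expandable_subst[unfolded expandable_def]) blast
  then obtain \<psi> where \<psi>: "\<And>i \<phi>. i \<in> J \<Longrightarrow> \<phi> \<in> \<Phi> \<Longrightarrow>
      subst \<phi> (f i) = (\<Sum>b\<in>index L. gscale (\<psi> i b) (term_value \<phi> b))"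
    by metis
  obtain c where c: "\<exists>i\<in>J. c i \<noteq> 0" "\<And>b. b \<in> index L \<Longrightarrow> (\<Sum>i\<in>J. c i * \<psi> i b) = 0"
    using underdetermined_system[OF finite_index assms(2,3), of \<psi>] by blast
  have "(\<Sum>i\<in>J. gscale (c i) (subst \<phi> (f i))) = 0" if "\<phi> \<in> \<Phi>" for \<phi>
  proof -
    have "(\<Sum>i\<in>J. gscale (c i) (subst \<phi> (f i)))
        = (\<Sum>i\<in>J. \<Sum>b\<in>index L. gscale (c i * \<psi> i b) (term_value \<phi> b))"
      using \<psi> that by (intro sum.cong refl) (simp add: gscale_sum)
    also have "\<dots> = (\<Sum>b\<in>index L. gscale (\<Sum>i\<in>J. c i * \<psi> i b) (term_value \<phi> b))"
      by (subst sum.swap) (simp add: gscale_sum_left)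
    finally show ?thesis using c(2) by simp
  qed
  with c(1) show ?thesis by blast
qed

end

section \<open>Dimensions and power spaces\<close>

text \<open>
  An independent list of maximal length spans. The predicate \<^const>\<open>ring.dim\<close> is meaningful only for
  spaces that are known to be finite-dimensional, hence the first conclusion.
\<close>

lemma (in ring) dim_le_if_independent_bounded:
  assumes "subfield K R" "subalgebra K P R"
    and bound: "\<And>Us. independent K Us \<Longrightarrow> set Us \<subseteq> P \<Longrightarrow> length Us \<le> N"
  shows "finite_dimension K P" "dim K P \<le> N"
proof -
  let ?Q = "\<lambda>Us. independent K Us \<and> set Us \<subseteq> P"
  obtain Us where Us: "?Q Us" and longest: "\<And>Vs. ?Q Vs \<Longrightarrow> length Vs \<le> length Us"
    using ex_has_greatest_nat[of ?Q "[]" length "Suc N"] bound by (auto simp: less_Suc_eq_le)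
  have "P \<subseteq> Span K Us"
  proof
    fix u assume u: "u \<in> P"
    show "u \<in> Span K Us"
    proof (rule ccontr)
      assume "u \<notin> Span K Us"
      then have "?Q (u # Us)"
        using Us u subalgebra_in_carrier[OF assms(2)] by (auto intro: li_Cons)
      from longest[OF this] show False by simp
    qed
  qed
  moreover have "Span K Us \<subseteq> P" using Us by (intro subalgebra_Span_incl assms) simp
  ultimately have "dimension (length Us) K P"
    using dimension_independent[of K Us] Us by (simp add: subset_antisym)
  then show "finite_dimension K P" "dim K P \<le> N"
    using dimI[OF assms(1)] bound[of Us] Us by (auto simp: over_def finite_dimension_def)
qed

lemma (in ring) independent_length_le_dim:
  assumes "subfield K R" "finite_dimension K P" "independent K Us" "set Us \<subseteq> P"
  shows "length Us \<le> dim K P"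
  using independent_length_le_dimension[OF assms(1) finite_dimensionE[OF assms(1,2)] assms(3,4)]
  by (simp add: over_def)

lemma (in ring) foldr_mult_closed:
  "set vs \<subseteq> carrier R \<Longrightarrow> foldr (\<otimes>) vs \<one> \<in> carrier R"
  by (induction vs) auto

lemma (in ring) power_space_is_subalgebra:
  assumes "K \<subseteq> carrier R" "V \<subseteq> carrier R"
  shows "subalgebra K (power_space R K V n) R"
proof -
  let ?W = "{W. subalgebra K W R \<and>
      {foldr (\<otimes>) vs \<one> |vs. set vs \<subseteq> V \<and> length vs \<le> n} \<subseteq> W}"
  have "carrier R \<in> ?W"
    using assms carrier_is_subalgebra foldr_mult_closed by blast
  then have "subgroup (\<Inter>?W) (add_monoid R)"
    by (intro add.subgroups_Inter) (auto simp: subalgebra_def)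
  moreover have "subalgebra_axioms K (\<Inter>?W) R"
    by (rule subalgebra_axioms.intro) (blast dest: subalgebra.smult_closed)
  ultimately show ?thesis unfolding power_space_def subalgebra_def by blast
qed

lemma power_space_least:
  assumes "subalgebra K W A"
    and "\<And>vs. set vs \<subseteq> V \<Longrightarrow> length vs \<le> n \<Longrightarrow> foldr (\<otimes>\<^bsub>A\<^esub>) vs \<one>\<^bsub>A\<^esub> \<in> W"
  shows "power_space A K V n \<subseteq> W"
  unfolding power_space_def using assms by blast

lemma product_in_power_space:
  "set vs \<subseteq> V \<Longrightarrow> length vs \<le> n \<Longrightarrow> foldr (\<otimes>\<^bsub>A\<^esub>) vs \<one>\<^bsub>A\<^esub> \<in> power_space A K V n"
  unfolding power_space_def by blast


section \<open>The free algebra on a set of variables\<close>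

lemma free_algebra_on_simps [simp]:
  "f \<otimes>\<^bsub>free_algebra_on X\<^esub> g = f * g" "f \<oplus>\<^bsub>free_algebra_on X\<^esub> g = f + g"
  "\<one>\<^bsub>free_algebra_on X\<^esub> = 1" "\<zero>\<^bsub>free_algebra_on X\<^esub> = 0"
  by (simp_all add: free_algebra_on_def)

lemma free_algebra_on_carrier:
  "f \<in> carrier (free_algebra_on X) \<longleftrightarrow> (\<forall>w\<in>Poly_Mapping.keys f. set (letters w) \<subseteq> X)"
  by (simp add: free_algebra_on_def)

lemma letters_zero [simp]: "letters 0 = []"
  by (simp add: zero_free_monoid_def)

lemma keys_one_free_algebra:
  "Poly_Mapping.keys (1 :: ('v, 'a::comm_ring_1) free_algebra) = {Word []}"
  by (simp add: single_one[symmetric] zero_free_monoid_def del: single_one)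

lemma free_algebra_on_closed:
  assumes "f \<in> carrier (free_algebra_on X)" "g \<in> carrier (free_algebra_on X)"
  shows "f + g \<in> carrier (free_algebra_on X)" "f * g \<in> carrier (free_algebra_on X)"
  using assms Poly_Mapping.keys_add[of f g] keys_mult[of f g]
  by (fastforce simp: free_algebra_on_carrier plus_free_monoid_def)+

lemma free_algebra_on_uminus_closed:
  "f \<in> carrier (free_algebra_on X) \<Longrightarrow> - f \<in> carrier (free_algebra_on X)"
  by (auto simp: free_algebra_on_carrier in_keys_iff)

lemma constants_in_free_algebra_on: "Poly_Mapping.single 0 c \<in> carrier (free_algebra_on X)"
  by (simp add: free_algebra_on_carrier)

lemma ring_free_algebra_on: "ring (free_algebra_on X)"
proof (rule ringI)
  show "abelian_group (free_algebra_on X)"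
  proof (rule abelian_groupI)
    show "\<zero>\<^bsub>free_algebra_on X\<^esub> \<in> carrier (free_algebra_on X)"
      by (simp add: free_algebra_on_carrier)
    fix f assume f: "f \<in> carrier (free_algebra_on X)"
    then show "\<exists>g\<in>carrier (free_algebra_on X). g \<oplus>\<^bsub>free_algebra_on X\<^esub> f = \<zero>\<^bsub>free_algebra_on X\<^esub>"
      by (intro bexI[of _ "- f"]) (simp_all add: free_algebra_on_uminus_closed)
  qed (simp_all add: free_algebra_on_closed add.assoc add.commute)
  show "Group.monoid (free_algebra_on X)"
    by (rule monoidI)
      (simp_all add: free_algebra_on_closed mult.assoc, simp add: free_algebra_on_carrier
        keys_one_free_algebra)
qed (simp_all add: distrib_left distrib_right)

lemma free_algebra_on_uminus:
  fixes f :: "('v, 'a::comm_ring_1) free_algebra"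
  assumes "f \<in> carrier (free_algebra_on X)"
  shows "\<ominus>\<^bsub>free_algebra_on X\<^esub> f = - f"
proof -
  interpret ring "free_algebra_on X :: ('v, 'a) free_algebra ring" by (rule ring_free_algebra_on)
  show ?thesis
    by (rule minus_equality) (simp_all add: assms free_algebra_on_uminus_closed)
qed

lemma subfield_constants:
  "subfield (range (Poly_Mapping.single 0))
     (free_algebra_on X :: ('v, 'a::field) free_algebra ring)"
proof -
  let ?R = "free_algebra_on X :: ('v, 'a::field) free_algebra ring"
  let ?K = "range (Poly_Mapping.single (0 :: 'v free_monoid)) :: ('v, 'a) free_algebra set"
  interpret ring ?R by (rule ring_free_algebra_on)
  have mult: "Poly_Mapping.single 0 a * Poly_Mapping.single 0 b =
      (Poly_Mapping.single 0 (a * b) :: ('v, 'a) free_algebra)" for a b :: 'a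
    by (simp add: mult_single)
  have "subring ?K ?R"
  proof (rule subringI)
    show "?K \<subseteq> carrier ?R" using constants_in_free_algebra_on by blast
    show "\<one>\<^bsub>?R\<^esub> \<in> ?K" by (simp flip: single_one)
    show "\<ominus>\<^bsub>?R\<^esub> f \<in> ?K" if "f \<in> ?K" for f
      using that by (auto simp: free_algebra_on_uminus constants_in_free_algebra_on
          simp flip: single_uminus)
    show "f \<otimes>\<^bsub>?R\<^esub> g \<in> ?K" "f \<oplus>\<^bsub>?R\<^esub> g \<in> ?K" if "f \<in> ?K" "g \<in> ?K" for f g
      using that by (auto simp: mult simp flip: single_add)
  qed
  then have "subcring ?K ?R"
    by (rule subcringI) (auto simp: mult mult.commute)
  moreover have "Units (?R\<lparr>carrier := ?K\<rparr>) = ?K - {\<zero>\<^bsub>?R\<^esub>}"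
  proof -
    have "\<exists>b. b * a = 1 \<and> a * b = 1" if "a \<noteq> 0" for a :: 'a
      using that by (intro exI[of _ "inverse a"]) simp
    moreover have "Poly_Mapping.single 0 a = (1 :: ('v, 'a) free_algebra) \<longleftrightarrow> a = 1" for a :: 'a
      by (metis lookup_single_eq single_one)
    moreover have "Poly_Mapping.single 0 a = (0 :: ('v, 'a) free_algebra) \<longleftrightarrow> a = 0" for a :: 'a
      by (metis lookup_single_eq single_zero)
    ultimately show ?thesis
      by (auto simp: Units_def mult)
  qed
  ultimately show ?thesis by (rule subfieldI)
qed


section \<open>The quotient by the identities\<close>

text \<open>
  The relatively free algebra of the identities that hold under all substitutions in \<open>\<Phi>\<close>.
  Nonemptiness of \<open>\<Phi>\<close> makes \<open>1\<close> a non-identity, so that the base field embeds.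
\<close>

locale identity_quotient =
  fixes X :: "'v set" and \<Phi> :: "('v \<Rightarrow> 'a::field grassmann) set"
  assumes substitutions_nonempty: "\<Phi> \<noteq> {}"
begin

abbreviation R :: "('v, 'a) free_algebra ring" where "R \<equiv> free_algebra_on X"

definition I :: "('v, 'a) free_algebra set" where
  "I = {f. \<forall>\<phi>\<in>\<Phi>. subst \<phi> f = 0} \<inter> carrier R"

abbreviation A :: "('v, 'a) free_algebra set ring" where "A \<equiv> R Quot I"

abbreviation coset :: "('v, 'a) free_algebra \<Rightarrow> ('v, 'a) free_algebra set" where
  "coset f \<equiv> I +>\<^bsub>R\<^esub> f"

abbreviation K :: "('v, 'a) free_algebra set set" where "K \<equiv> scalars X I"

sublocale R: ring R by (rule ring_free_algebra_on)

lemma ideal_identities: "ideal I R"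
proof (rule idealI)
  show "ring R" by (rule ring_free_algebra_on)
  show "subgroup I (add_monoid R)"
  proof (rule R.add.subgroupI)
    have "0 \<in> I" using R.zero_closed by (simp add: I_def)
    then show "I \<noteq> {}" by blast
  qed (auto simp: I_def free_algebra_on_closed free_algebra_on_uminus_closed subst_add
      subst_uminus free_algebra_on_uminus simp flip: a_inv_def)
qed (auto simp: I_def subst_mult free_algebra_on_closed)

sublocale I: ideal I R by (rule ideal_identities)

sublocale A: ring A by (rule I.quotient_is_ring)

sublocale coset: ring_hom_ring R A coset by (rule I.rcos_ring_hom_ring)

lemma coset_eq_zero_iff: "f \<in> carrier R \<Longrightarrow> coset f = \<zero>\<^bsub>A\<^esub> \<longleftrightarrow> f \<in> I"
  using I.rcos_const_imp_mem[of f] I.a_rcos_const[of f] by (auto simp: FactRing_def)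

lemma one_not_zero: "\<one>\<^bsub>A\<^esub> \<noteq> \<zero>\<^bsub>A\<^esub>"
proof -
  obtain \<phi> where "\<phi> \<in> \<Phi>" using substitutions_nonempty by blast
  moreover have "subst \<phi> 1 = 1"
    using subst_single[of \<phi> 0 1] by simp
  ultimately have "1 \<notin> I" by (auto simp: I_def)
  then show ?thesis
    using coset_eq_zero_iff[of 1] coset.hom_one R.one_closed by simp
qed

lemma scalars_eq: "K = coset ` range (Poly_Mapping.single 0)"
  by (simp add: scalars_def image_image)

lemma subfield_scalars: "subfield K A"
  unfolding scalars_eq by (rule coset.img_is_subfield[OF subfield_constants one_not_zero])

lemma coset_constant_eq_zero_iff: "coset (Poly_Mapping.single 0 c) = \<zero>\<^bsub>A\<^esub> \<longleftrightarrow> c = 0"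
proof -
  have "inj_on coset (range (Poly_Mapping.single 0))"
    by (rule coset.img_is_subfield[OF subfield_constants one_not_zero])
  then have "coset (Poly_Mapping.single 0 c) = coset (Poly_Mapping.single 0 0) \<longleftrightarrow>
      (Poly_Mapping.single 0 c :: ('v, 'a) free_algebra) = Poly_Mapping.single 0 0"
    by (rule inj_on_eq_iff) blast+
  also have "\<dots> \<longleftrightarrow> c = 0" by (metis lookup_single_eq)
  finally show ?thesis using coset.hom_zero by simp
qed

lemma carrier_quotient: "carrier A = coset ` carrier R"
  by (auto simp: FactRing_def A_RCOSETS_def')

lemma subst_constant_mult: "subst \<phi> (Poly_Mapping.single 0 c * f) = gscale c (subst \<phi> f)"
  by (simp add: subst_mult subst_single gscale_mult)

lemma subst_combine:
  "subst \<phi> (R.combine (map (\<lambda>i. Poly_Mapping.single 0 (c i)) is) (map f is)) =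
     (\<Sum>i\<leftarrow>is. gscale (c i) (subst \<phi> (f i)))"
  by (induction "is") (simp_all add: subst_add subst_constant_mult)

text \<open>
  This translates linear dependence in the quotient, where scalars are cosets of constants, into
  a statement about coefficients in the base field and values under substitutions. Both growth
  bounds rest on it.
\<close>

lemma dependent_cosets_iff:
  assumes "\<And>i. i < n \<Longrightarrow> f i \<in> carrier R"
  shows "A.dependent K (map (\<lambda>i. coset (f i)) [0..<n]) \<longleftrightarrow>
    (\<exists>c. (\<exists>i<n. c i \<noteq> 0) \<and> (\<forall>\<phi>\<in>\<Phi>. (\<Sum>i<n. gscale (c i) (subst \<phi> (f i))) = 0))"
proof -
  let ?us = "map (\<lambda>i. coset (f i)) [0..<n]"
  have us: "set ?us \<subseteq> carrier A" using assms by (auto simp: carrier_quotient)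
  have combine: "A.combine (map (\<lambda>i. coset (Poly_Mapping.single 0 (c i))) [0..<n]) ?us = \<zero>\<^bsub>A\<^esub> \<longleftrightarrow>
      (\<forall>\<phi>\<in>\<Phi>. (\<Sum>i<n. gscale (c i) (subst \<phi> (f i))) = 0)" for c
  proof -
    let ?Ks = "map (\<lambda>i. Poly_Mapping.single 0 (c i)) [0..<n]" and ?fs = "map f [0..<n]"
    have "set ?Ks \<subseteq> carrier R" "set ?fs \<subseteq> carrier R"
      using assms constants_in_free_algebra_on by auto
    note hom = coset.combine_hom[OF this] and closed = R.combine_in_carrier[OF this]
    have "R.combine ?Ks ?fs \<in> I \<longleftrightarrow> (\<forall>\<phi>\<in>\<Phi>. (\<Sum>i<n. gscale (c i) (subst \<phi> (f i))) = 0)"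
      using closed
      by (simp add: I_def subst_combine sum_list_distinct_conv_sum_set atLeast0LessThan)
    then show ?thesis
      using hom coset_eq_zero_iff[OF closed] by (simp add: comp_def)
  qed
  show ?thesis
  proof
    assume "A.dependent K ?us"
    from A.dependent_imp_non_trivial_combine[OF subfield_scalars us this]
    obtain Ks where Ks: "length Ks = n" "A.combine Ks ?us = \<zero>\<^bsub>A\<^esub>" "set Ks \<subseteq> K" "set Ks \<noteq> {\<zero>\<^bsub>A\<^esub>}"
      by auto
    have "n \<noteq> 0" using \<open>A.dependent K ?us\<close> by (cases n) auto
    have "\<exists>c. Ks ! i = coset (Poly_Mapping.single 0 c)" if "i < n" for i
    proof -
      have "Ks ! i \<in> K" using nth_mem[of i Ks] Ks(1,3) that by auto
      then show ?thesis by (auto simp: scalars_def)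
    qed
    then obtain c where c: "\<And>i. i < n \<Longrightarrow> Ks ! i = coset (Poly_Mapping.single 0 (c i))"
      by metis
    have Ks_eq: "Ks = map (\<lambda>i. coset (Poly_Mapping.single 0 (c i))) [0..<n]"
      by (rule nth_equalityI) (simp_all add: Ks(1) c)
    have "\<exists>i<n. c i \<noteq> 0"
    proof (rule ccontr)
      assume "\<not> ?thesis"
      then have "set Ks = {\<zero>\<^bsub>A\<^esub>}"
        using \<open>n \<noteq> 0\<close> coset_constant_eq_zero_iff[of 0] by (auto simp: Ks_eq)
      then show False using Ks(4) by blast
    qed
    then show "\<exists>c. (\<exists>i<n. c i \<noteq> 0) \<and> (\<forall>\<phi>\<in>\<Phi>. (\<Sum>i<n. gscale (c i) (subst \<phi> (f i))) = 0)"
      using Ks(2) combine[of c] unfolding Ks_eq by blast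
  next
    assume "\<exists>c. (\<exists>i<n. c i \<noteq> 0) \<and> (\<forall>\<phi>\<in>\<Phi>. (\<Sum>i<n. gscale (c i) (subst \<phi> (f i))) = 0)"
    then obtain c where c: "\<exists>i<n. c i \<noteq> 0"
      "\<forall>\<phi>\<in>\<Phi>. (\<Sum>i<n. gscale (c i) (subst \<phi> (f i))) = 0" by blast
    let ?Ks = "map (\<lambda>i. coset (Poly_Mapping.single 0 (c i))) [0..<n]"
    have "set ?Ks \<subseteq> K" by (auto simp: scalars_def)
    moreover have "A.combine ?Ks ?us = \<zero>\<^bsub>A\<^esub>" using c(2) combine by blast
    moreover have "\<not> set (take (length ?us) ?Ks) \<subseteq> {\<zero>\<^bsub>A\<^esub>}"
    proof -
      obtain i where "i < n" "c i \<noteq> 0" using c(1) by blast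
      then have "coset (Poly_Mapping.single 0 (c i)) \<in> set ?Ks"
        "coset (Poly_Mapping.single 0 (c i)) \<noteq> \<zero>\<^bsub>A\<^esub>"
        by (auto simp: coset_constant_eq_zero_iff)
      then show ?thesis by auto
    qed
    ultimately show "A.dependent K ?us"
      by (rule A.non_trivial_combine_imp_dependent[OF subfield_scalars])
  qed
qed

text \<open>
  The degree filtration of the free algebra; its image in the quotient controls the powers of
  every finite-dimensional subspace.
\<close>

definition bounded_degree :: "nat \<Rightarrow> ('v, 'a) free_algebra set" where
  "bounded_degree L = {f \<in> carrier R. \<forall>w\<in>Poly_Mapping.keys f. length (letters w) \<le> L}"

lemma bounded_degree_mult:
  assumes "f \<in> bounded_degree L" "g \<in> bounded_degree L'"
  shows "f * g \<in> bounded_degree (L + L')"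
  using assms keys_mult[of f g] free_algebra_on_closed(2)[of f X g]
  by (fastforce simp: bounded_degree_def plus_free_monoid_def intro: add_mono)

lemma constants_in_bounded_degree: "Poly_Mapping.single 0 c \<in> bounded_degree L"
  by (simp add: bounded_degree_def constants_in_free_algebra_on)

lemma bounded_degree_mono: "L \<le> L' \<Longrightarrow> bounded_degree L \<subseteq> bounded_degree L'"
  by (auto simp: bounded_degree_def)

lemma subalgebra_bounded_degree: "subalgebra K (coset ` bounded_degree L) A"
proof -
  have "subgroup (bounded_degree L) (add_monoid R)"
  proof (rule R.add.subgroupI)
    show "bounded_degree L \<noteq> {}" using constants_in_bounded_degree by blast
    show "f \<oplus>\<^bsub>R\<^esub> g \<in> bounded_degree L" if "f \<in> bounded_degree L" "g \<in> bounded_degree L" for f g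
      using that Poly_Mapping.keys_add[of f g]
      by (fastforce simp: bounded_degree_def free_algebra_on_closed)
    show "\<ominus>\<^bsub>R\<^esub> f \<in> bounded_degree L" if "f \<in> bounded_degree L" for f
      using that
      by (subst free_algebra_on_uminus)
        (auto simp: bounded_degree_def free_algebra_on_uminus_closed in_keys_iff)
  qed (auto simp: bounded_degree_def)
  then have "subalgebra (range (Poly_Mapping.single 0)) (bounded_degree L) R"
    using bounded_degree_mult[OF constants_in_bounded_degree[of _ 0], of _ L]
    by (auto simp: subalgebra_def subalgebra_axioms_def)
  then show ?thesis
    unfolding scalars_eq
    by (intro coset.img_is_subalgebra) (use constants_in_free_algebra_on in blast)
qed

lemma power_space_bounded_degree:
  assumes "V \<subseteq> coset ` bounded_degree N"
  shows "power_space A K V n \<subseteq> coset ` bounded_degree (n * N)"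
proof (rule power_space_least[OF subalgebra_bounded_degree])
  fix vs assume "set vs \<subseteq> V" "length vs \<le> n"
  have "foldr (\<otimes>\<^bsub>A\<^esub>) vs \<one>\<^bsub>A\<^esub> \<in> coset ` bounded_degree (length vs * N)"
    using \<open>set vs \<subseteq> V\<close>
  proof (induction vs)
    case Nil
    have "1 \<in> bounded_degree 0" using constants_in_bounded_degree[of 1 0] by simp
    then show ?case using coset.hom_one by auto
  next
    case (Cons v vs)
    then obtain f g where f: "v = coset f" "f \<in> bounded_degree N"
      and g: "foldr (\<otimes>\<^bsub>A\<^esub>) vs \<one>\<^bsub>A\<^esub> = coset g" "g \<in> bounded_degree (length vs * N)"
      using assms by auto
    have "coset (f * g) = v \<otimes>\<^bsub>A\<^esub> foldr (\<otimes>\<^bsub>A\<^esub>) vs \<one>\<^bsub>A\<^esub>"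
      using coset.hom_mult[of f g] f g by (simp add: bounded_degree_def)
    moreover have "f * g \<in> bounded_degree (length (v # vs) * N)"
      using bounded_degree_mult[OF f(2) g(2)] by simp
    ultimately show ?case by (metis foldr.simps(2) image_eqI o_apply)
  qed
  then show "foldr (\<otimes>\<^bsub>A\<^esub>) vs \<one>\<^bsub>A\<^esub> \<in> coset ` bounded_degree (n * N)"
    using bounded_degree_mono[of "length vs * N" "n * N"] \<open>length vs \<le> n\<close> by auto
qed

text \<open>
  A basis of \<open>V\<close> has finitely many representatives, and each of these is a polynomial.
\<close>

lemma finite_dimension_bounded_degree:
  assumes "A.finite_dimension K V"
  obtains N where "V \<subseteq> coset ` bounded_degree N"
proof -
  obtain k where "A.dimension k K V" using assms by (auto simp: A.finite_dimension_def)
  then obtain vs where vs: "set vs \<subseteq> carrier A" "A.Span K vs = V"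
    using A.exists_base[OF subfield_scalars] by blast
  have "\<exists>N. set vs \<subseteq> coset ` bounded_degree N"
    using vs(1)
  proof (induction vs)
    case (Cons v vs)
    then obtain N f where N: "set vs \<subseteq> coset ` bounded_degree N"
      and f: "v = coset f" "f \<in> carrier R"
      by (auto simp: carrier_quotient)
    define N' where "N' = Max (insert N ((\<lambda>w. length (letters w)) ` Poly_Mapping.keys f))"
    have "N \<le> N'" by (simp add: N'_def)
    have "f \<in> bounded_degree N'" using f(2) by (simp add: bounded_degree_def N'_def)
    then have "set (v # vs) \<subseteq> coset ` bounded_degree N'"
      using N f(1) bounded_degree_mono[OF \<open>N \<le> N'\<close>] by auto
    then show ?case by blast
  qed simp
  then obtain N where "set vs \<subseteq> coset ` bounded_degree N" by blast
  then have "V \<subseteq> coset ` bounded_degree N"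
    using A.subalgebra_Span_incl[OF subfield_scalars subalgebra_bounded_degree] vs(2) by blast
  then show ?thesis by (rule that)
qed

end

section \<open>Upper bound for the growth\<close>

locale expanded_quotient = identity_quotient X \<Phi> + word_expansion X0 X M \<Phi>
  for X0 X :: "'v set" and M :: nat and \<Phi> :: "('v \<Rightarrow> 'a::field grassmann) set"
begin

lemma independent_bounded_degree:
  assumes "A.independent K us" "set us \<subseteq> coset ` bounded_degree L"
  shows "length us \<le> card (index L)"
proof (rule ccontr)
  assume long: "\<not> ?thesis"
  have "\<exists>f. f \<in> bounded_degree L \<and> us ! i = coset f" if "i < length us" for i
    using assms(2) nth_mem[OF that] by blast
  then obtain f where f: "\<And>i. i < length us \<Longrightarrow> f i \<in> bounded_degree L"
    "\<And>i. i < length us \<Longrightarrow> us ! i = coset (f i)" by metis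
  have us: "us = map (\<lambda>i. coset (f i)) [0..<length us]"
    by (rule nth_equalityI) (simp_all add: f(2))
  have "\<exists>c. (\<exists>i\<in>{..<length us}. c i \<noteq> 0) \<and>
      (\<forall>\<phi>\<in>\<Phi>. (\<Sum>i\<in>{..<length us}. gscale (c i) (subst \<phi> (f i))) = 0)"
    using f(1) long
    by (intro subst_linearly_dependent[where L = L])
      (auto simp: bounded_degree_def free_algebra_on_carrier)
  then have "A.dependent K (map (\<lambda>i. coset (f i)) [0..<length us])"
    using f(1) by (subst dependent_cosets_iff) (auto simp: bounded_degree_def)
  then show False using assms(1) us by simp
qed

lemma
  assumes "V \<subseteq> coset ` bounded_degree N"
  shows finite_dimension_power_space: "A.finite_dimension K (power_space A K V n)"
    and growth_le: "growth A K V n \<le> card (index (n * N))"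
proof -
  have "K \<subseteq> carrier A" by (rule subfieldE(3)[OF subfield_scalars])
  moreover have "V \<subseteq> carrier A"
    using assms by (auto simp: carrier_quotient bounded_degree_def)
  ultimately have P: "subalgebra K (power_space A K V n) A"
    by (rule A.power_space_is_subalgebra)
  have bound: "length us \<le> card (index (n * N))"
    if "A.independent K us" "set us \<subseteq> power_space A K V n" for us
    using that power_space_bounded_degree[OF assms] by (blast intro: independent_bounded_degree)
  show "A.finite_dimension K (power_space A K V n)" "growth A K V n \<le> card (index (n * N))"
    unfolding growth_def
    using A.dim_le_if_independent_bounded[OF subfield_scalars P bound] by blast+
qed

end

section \<open>Polynomial functions over an infinite field\<close>

lemma polynomial_function_eq_zero:
  fixes b :: "nat \<Rightarrow> 'a::field"
  assumes "infinite (UNIV :: 'a set)" "\<And>s. (\<Sum>j\<le>q. b j * s ^ j) = 0" "j \<le> q"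
  shows "b j = 0"
proof -
  define P where "P = (\<Sum>j\<le>q. monom (b j) j)"
  have "poly P s = 0" for s
    using assms(2)[of s] by (simp add: P_def poly_sum poly_monom)
  then have "P = 0" using poly_roots_finite[of P] assms(1) by auto
  moreover have "coeff P j = b j"
    using assms(3) by (simp add: P_def coeff_sum)
  ultimately show ?thesis by simp
qed

text \<open>
  By induction on the number of variables: for fixed values of the variables in \<open>S\<close>, the sum is
  a univariate polynomial function of the value of \<open>x\<close>, whose coefficients are polynomial
  functions in the remaining variables.
\<close>

lemma multivariate_polynomial_function_eq_zero:
  fixes c :: "('v \<Rightarrow> nat) \<Rightarrow> 'a::field"
  assumes "infinite (UNIV :: 'a set)" "finite S"
    and "\<And>t. (\<Sum>\<alpha>\<in>S \<rightarrow>\<^sub>E {..q}. c \<alpha> * (\<Prod>v\<in>S. t v ^ \<alpha> v)) = 0"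
    and "\<alpha> \<in> S \<rightarrow>\<^sub>E {..q}"
  shows "c \<alpha> = 0"
  using assms(2-)
proof (induction S arbitrary: c \<alpha>)
  case empty
  then show ?case by simp
next
  case (insert x S)
  let ?B = "S \<rightarrow>\<^sub>E {..q}"
  have split: "(\<Sum>\<alpha>\<in>insert x S \<rightarrow>\<^sub>E {..q}. F \<alpha>) = (\<Sum>j\<le>q. \<Sum>\<beta>\<in>?B. F (\<beta>(x := j)))"
    for F :: "('v \<Rightarrow> nat) \<Rightarrow> 'a"
  proof -
    have "inj_on (\<lambda>(j, \<beta>). \<beta>(x := j)) ({..q} \<times> ?B)"
      using insert.hyps(2) by (rule inj_combinator)
    then show ?thesis
      by (simp add: PiE_insert_eq sum.reindex sum.cartesian_product split_def comp_def)
  qed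
  have coefficient: "(\<Sum>\<beta>\<in>?B. c (\<beta>(x := j)) * (\<Prod>v\<in>S. t v ^ \<beta> v)) = 0" if "j \<le> q" for j t
  proof (rule polynomial_function_eq_zero[OF assms(1) _ that])
    fix s
    have "(\<Sum>j\<le>q. (\<Sum>\<beta>\<in>?B. c (\<beta>(x := j)) * (\<Prod>v\<in>S. t v ^ \<beta> v)) * s ^ j) =
        (\<Sum>j\<le>q. \<Sum>\<beta>\<in>?B. c (\<beta>(x := j)) *
          (\<Prod>v\<in>insert x S. (t(x := s)) v ^ (\<beta>(x := j)) v))"
    proof (intro sum.cong refl)
      fix j
      have "(\<Prod>v\<in>insert x S. (t(x := s)) v ^ (\<beta>(x := j)) v) = s ^ j * (\<Prod>v\<in>S. t v ^ \<beta> v)" for \<beta>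
      proof -
        have "(\<Prod>v\<in>S. (t(x := s)) v ^ (\<beta>(x := j)) v) = (\<Prod>v\<in>S. t v ^ \<beta> v)"
          using insert.hyps(2) by (intro prod.cong) auto
        then show ?thesis using insert.hyps by simp
      qed
      then show "(\<Sum>\<beta>\<in>?B. c (\<beta>(x := j)) * (\<Prod>v\<in>S. t v ^ \<beta> v)) * s ^ j =
        (\<Sum>\<beta>\<in>?B. c (\<beta>(x := j)) * (\<Prod>v\<in>insert x S. (t(x := s)) v ^ (\<beta>(x := j)) v))"
        by (simp only: sum_distrib_right) (simp only: ac_simps)
    qed
    also have "\<dots> = 0" using insert.prems(1)[of "t(x := s)"] unfolding split .
    finally show "(\<Sum>j\<le>q. (\<Sum>\<beta>\<in>?B. c (\<beta>(x := j)) * (\<Prod>v\<in>S. t v ^ \<beta> v)) * s ^ j) = 0" .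
  qed
  have "\<alpha> \<in> (\<lambda>(j, \<beta>). \<beta>(x := j)) ` ({..q} \<times> ?B)"
    using insert.prems(2) by (simp add: PiE_insert_eq)
  then obtain j \<beta> where \<alpha>: "\<alpha> = \<beta>(x := j)" "j \<le> q" "\<beta> \<in> ?B" by auto
  show ?case
    unfolding \<alpha>(1)
    by (rule insert.IH[of "\<lambda>\<beta>. c (\<beta>(x := j))", OF coefficient[OF \<alpha>(2)] \<alpha>(3)])
qed

section \<open>Lower bound for the growth\<close>

lemma log_ratio_limits:
  fixes a C :: real
  assumes "a > 0" "C > 0"
  shows "(\<lambda>n. log (real n) ((real n * a + 1) ^ k * C)) \<longlonglongrightarrow> real k"
    and "(\<lambda>n. real k * log (real n) (real n / a)) \<longlonglongrightarrow> real k"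
proof -
  have "(\<lambda>n. ln (real n * a + 1) / ln (real n)) \<longlonglongrightarrow> 1"
    "(\<lambda>n. ln C / ln (real n)) \<longlonglongrightarrow> 0"
    using assms by real_asymp+
  then have "(\<lambda>n. real k * (ln (real n * a + 1) / ln (real n)) + ln C / ln (real n))
      \<longlonglongrightarrow> real k * 1 + 0"
    by (intro tendsto_intros)
  moreover have "log (real n) ((real n * a + 1) ^ k * C) =
      real k * (ln (real n * a + 1) / ln (real n)) + ln C / ln (real n)" for n
  proof -
    have "real n * a + 1 > 0" using assms by (simp add: add_nonneg_pos)
    then show ?thesis
      using assms by (simp add: log_def ln_mult ln_realpow add_divide_distrib)
  qed
  ultimately show "(\<lambda>n. log (real n) ((real n * a + 1) ^ k * C)) \<longlonglongrightarrow> real k" by simp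
  have "(\<lambda>n. ln (real n / a) / ln (real n)) \<longlonglongrightarrow> 1"
    using assms by real_asymp
  then have "(\<lambda>n. real k * (ln (real n / a) / ln (real n))) \<longlonglongrightarrow> real k * 1"
    by (intro tendsto_intros)
  then show "(\<lambda>n. real k * log (real n) (real n / a)) \<longlonglongrightarrow> real k"
    by (simp add: log_def)
qed

lemma scalar_part_gscale: "scalar_part (gscale c x) = c * scalar_part x"
  by (simp add: scalar_part_def)

lemma scalar_part_one: "scalar_part 1 = 1"
  by (simp add: scalar_part_def coords_simps)

lemma scalar_part_sum: "scalar_part (\<Sum>i\<in>A. f i) = (\<Sum>i\<in>A. scalar_part (f i))"
  by (simp add: scalar_part_def coords_sum lookup_sum)

lemma prod_list_scalars:
  "prod_list (map (\<lambda>v. gscale (t v) (1 :: 'a::comm_ring_1 grassmann)) w) =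
     gscale (prod_list (map t w)) 1"
  by (induction w) (simp_all add: gscale_mult mult.commute)

definition sorted_word :: "'v list \<Rightarrow> ('v \<Rightarrow> nat) \<Rightarrow> 'v list" where
  "sorted_word xs \<alpha> = concat (map (\<lambda>x. replicate (\<alpha> x) x) xs)"

lemma length_sorted_word: "length (sorted_word xs \<alpha>) = (\<Sum>x\<leftarrow>xs. \<alpha> x)"
  by (simp add: sorted_word_def length_concat comp_def)

lemma set_sorted_word: "set (sorted_word xs \<alpha>) \<subseteq> set xs"
  by (auto simp: sorted_word_def)

lemma prod_list_sorted_word:
  fixes t :: "'v \<Rightarrow> 'a::comm_monoid_mult"
  assumes "distinct xs"
  shows "prod_list (map t (sorted_word xs \<alpha>)) = (\<Prod>x\<in>set xs. t x ^ \<alpha> x)"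
proof -
  have "prod_list (map t (sorted_word xs \<alpha>)) = prod_list (map (\<lambda>x. t x ^ \<alpha> x) xs)"
    by (induction xs) (simp_all add: sorted_word_def prod_list_replicate map_replicate)
  then show ?thesis using prod.distinct_set_conv_list[OF assms] by metis
qed

text \<open>
  With an infinite base field and arbitrary scalars as values of the variables in \<open>X0\<close>, the
  quotient maps onto the polynomial algebra in these variables, so that the upper bound for the
  growth has the right order.
\<close>

locale quotient_with_scalars = expanded_quotient X0 X M \<Phi>
  for X0 X :: "'v set" and M :: nat and \<Phi> :: "('v \<Rightarrow> 'a::field grassmann) set" +
  assumes infinite_field: "infinite (UNIV :: 'a set)"
    and scalar_substitutions: "\<And>t. (\<lambda>v. gscale (if v \<in> X0 then t v else 0) 1) \<in> \<Phi>"
begin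

text \<open>
  The span of the variables in \<open>X0\<close>. Spans are formed from lists, and any enumeration of \<open>X0\<close>
  will do.
\<close>

definition generator_space :: "('v, 'a) free_algebra set set" where
  "generator_space = A.Span K (map (\<lambda>v. coset (Poly_Mapping.single (Word [v]) 1))
     (SOME xs. set xs = X0 \<and> distinct xs))"

lemma generator_space:
  shows "A.finite_dimension K generator_space"
    and "\<And>v. v \<in> X0 \<Longrightarrow> coset (Poly_Mapping.single (Word [v]) 1) \<in> generator_space"
proof -
  let ?xs = "SOME xs. set xs = X0 \<and> distinct xs"
  let ?us = "map (\<lambda>v. coset (Poly_Mapping.single (Word [v]) 1)) ?xs"
  have xs: "set ?xs = X0"
    using someI_ex[OF finite_distinct_list[OF finite_X0]] by blast
  have us: "set ?us \<subseteq> carrier A"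
    using vars_subset xs by (auto simp: carrier_quotient free_algebra_on_carrier)
  show "A.finite_dimension K generator_space"
    unfolding generator_space_def by (rule A.Span_finite_dimension[OF subfield_scalars us])
  show "coset (Poly_Mapping.single (Word [v]) 1) \<in> generator_space" if "v \<in> X0" for v
    using A.Span_base_incl[OF subfield_scalars us] that xs by (auto simp: generator_space_def)
qed

lemma coset_word:
  assumes "set w \<subseteq> X0"
  shows "coset (Poly_Mapping.single (Word w) 1) =
    foldr (\<otimes>\<^bsub>A\<^esub>) (map (\<lambda>v. coset (Poly_Mapping.single (Word [v]) 1)) w) \<one>\<^bsub>A\<^esub>"
  using assms
proof (induction w)
  case Nil
  then show ?case using coset.hom_one by (simp flip: zero_free_monoid_def)
next
  case (Cons v w)
  let ?v = "Poly_Mapping.single (Word [v]) 1 :: ('v, 'a) free_algebra"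
  let ?w = "Poly_Mapping.single (Word w) 1 :: ('v, 'a) free_algebra"
  have "?v \<in> carrier R" "?w \<in> carrier R"
    using Cons.prems vars_subset by (auto simp: free_algebra_on_carrier)
  from coset.hom_mult[OF this] have "coset (?v * ?w) = coset ?v \<otimes>\<^bsub>A\<^esub> coset ?w" by simp
  moreover have "?v * ?w = Poly_Mapping.single (Word (v # w)) 1"
    by (simp add: mult_single plus_free_monoid_def)
  ultimately show ?case using Cons by simp
qed

text \<open>
  The monomials in \<open>X0\<close> with all exponents at most \<open>q\<close> have degree at most \<open>|X0| q\<close>, and a
  linear relation between them in the quotient, evaluated at scalars, is a polynomial function
  that vanishes identically.
\<close>

lemma growth_generator_space_ge:
  assumes "card X0 * q \<le> n"
  shows "(q + 1) ^ card X0 \<le> growth A K generator_space n"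
proof -
  let ?B = "X0 \<rightarrow>\<^sub>E {..q}"
  obtain xs where xs: "set xs = X0" "distinct xs" using finite_distinct_list[OF finite_X0] by blast
  have "finite ?B" using finite_X0 by (intro finite_PiE) auto
  obtain bs where bs: "set bs = ?B" "distinct bs"
    using finite_distinct_list[OF \<open>finite ?B\<close>] by blast
  define r where "r = length bs"
  have r: "r = (q + 1) ^ card X0"
    using distinct_card[OF bs(2)] bs(1) finite_X0 by (simp add: r_def card_PiE)
  define f where "f i = (Poly_Mapping.single (Word (sorted_word xs (bs ! i))) 1 ::
    ('v, 'a) free_algebra)" for i
  let ?us = "map (\<lambda>i. coset (f i)) [0..<r]"
  have nth_B: "bs ! i \<in> ?B" if "i < r" for i
    using nth_mem that bs(1) unfolding r_def by blast
  have "A.independent K ?us"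
  proof (rule ccontr)
    assume "A.dependent K ?us"
    moreover have "f i \<in> carrier R" for i
      using subset_trans[OF set_sorted_word[of xs "bs ! i"]] xs(1) vars_subset
      by (simp add: f_def free_algebra_on_carrier)
    ultimately obtain c where c: "\<exists>i<r. c i \<noteq> 0"
      "\<And>\<phi>. \<phi> \<in> \<Phi> \<Longrightarrow> (\<Sum>i<r. gscale (c i) (subst \<phi> (f i))) = 0"
      using dependent_cosets_iff[of r f] by blast
    have bij: "bij_betw (nth bs) {..<r} ?B"
      using bs by (simp add: r_def bij_betw_nth)
    \<comment> \<open>the coefficients reindexed by exponents instead of positions in the list\<close>
    define c' where "c' = c \<circ> inv_into {..<r} (nth bs)"
    have c': "c' (bs ! i) = c i" if "i < r" for i
      using bij_betw_inv_into_left[OF bij, of i] that by (simp add: c'_def)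
    have "(\<Sum>\<alpha>\<in>?B. c' \<alpha> * (\<Prod>v\<in>X0. t v ^ \<alpha> v)) = 0" for t
    proof -
      let ?\<phi> = "\<lambda>v. gscale (if v \<in> X0 then t v else 0) (1 :: 'a grassmann)"
      have "(\<Prod>v\<in>X0. (if v \<in> X0 then t v else 0) ^ \<alpha> v) = (\<Prod>v\<in>X0. t v ^ \<alpha> v)" for \<alpha> :: "'v \<Rightarrow> nat"
        by (intro prod.cong) auto
      then have "subst ?\<phi> (f i) = gscale (\<Prod>v\<in>X0. t v ^ (bs ! i) v) 1" for i
        using prod_list_sorted_word[OF xs(2), of "\<lambda>v. if v \<in> X0 then t v else 0"] xs(1)
        by (simp only: f_def subst_single free_monoid.sel prod_list_scalars) simp
      then have "0 = scalar_part (\<Sum>i<r. gscale (c i) (gscale (\<Prod>v\<in>X0. t v ^ (bs ! i) v) 1))"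
        using c(2)[OF scalar_substitutions[of t]]
        by (simp add: scalar_part_def zero_grassmann.rep_eq)
      also have "\<dots> = (\<Sum>i<r. c' (bs ! i) * (\<Prod>v\<in>X0. t v ^ (bs ! i) v))"
        by (simp add: scalar_part_sum scalar_part_gscale scalar_part_one c')
      also have "\<dots> = (\<Sum>\<alpha>\<in>?B. c' \<alpha> * (\<Prod>v\<in>X0. t v ^ \<alpha> v))"
        using bij by (rule sum.reindex_bij_betw)
      finally show ?thesis by simp
    qed
    from multivariate_polynomial_function_eq_zero[OF infinite_field finite_X0 this]
    have "c' (bs ! i) = 0" if "i < r" for i using nth_B[OF that] by blast
    with c(1) c' show False by auto
  qed
  moreover have "set ?us \<subseteq> power_space A K generator_space n"
  proof -
    have "coset (f i) \<in> power_space A K generator_space n" if "i < r" for i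
    proof -
      let ?w = "sorted_word xs (bs ! i)"
      have "length ?w = (\<Sum>x\<in>X0. (bs ! i) x)"
        using sum.distinct_set_conv_list[OF xs(2), of "bs ! i"] xs(1)
        by (simp add: length_sorted_word)
      also have "\<dots> \<le> card X0 * q"
        using sum_bounded_above[of X0 "bs ! i" q] nth_B[OF that] by (auto simp: PiE_iff)
      finally have "length ?w \<le> n" using assms by simp
      moreover have "set ?w \<subseteq> X0" using set_sorted_word xs(1) by metis
      ultimately show ?thesis
        unfolding f_def coset_word[OF \<open>set ?w \<subseteq> X0\<close>]
        using generator_space(2) by (intro product_in_power_space) auto
    qed
    then show ?thesis by auto
  qed
  moreover obtain N where "generator_space \<subseteq> coset ` bounded_degree N"
    using finite_dimension_bounded_degree[OF generator_space(1)] by blast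
  then have "A.finite_dimension K (power_space A K generator_space n)"
    by (rule finite_dimension_power_space)
  ultimately have "length ?us \<le> A.dim K (power_space A K generator_space n)"
    using A.independent_length_le_dim[OF subfield_scalars] by blast
  then show ?thesis by (simp add: growth_def r)
qed

text \<open>
  To the base \<open>n\<close>, the logarithms of the bounds \<open>C (n N + 1)\<^sup>k\<close> and \<open>(n / k)\<^sup>k\<close> both tend to
  \<open>k\<close>. The upper bound holds for every subspace in the supremum, and the span of the variables
  in \<open>X0\<close> attains it.
\<close>

theorem GK_dim_eq_card: "GK_dim A K = ereal (real (card X0))"
proof (rule antisym)
  let ?k = "card X0"
  show "GK_dim A K \<le> ereal (real ?k)"
    unfolding GK_dim_def
  proof (rule SUP_least)
    fix V assume "V \<in> {V. A.finite_dimension K V}"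
    then obtain N where "V \<subseteq> coset ` bounded_degree N"
      using finite_dimension_bounded_degree by blast
    \<comment> \<open>\<open>Suc N\<close> because the limit of the comparison function is computed for a positive bound\<close>
    then have V: "V \<subseteq> coset ` bounded_degree (Suc N)"
      using bounded_degree_mono[of N "Suc N"] by auto
    define C where "C = card {u. set u \<subseteq> X \<and> length u \<le> M}"
    have "{u. set u \<subseteq> X \<and> length u \<le> M} \<noteq> {}"
      by (auto intro!: exI[of _ "[]"])
    then have "C > 0"
      unfolding C_def using finite_lists_length_le[OF finite_vars] by (simp add: card_gt_0_iff)
    let ?g = "\<lambda>n. log (real n) ((real n * real (Suc N) + 1) ^ ?k * real C)"
    have "log (real n) (real (growth A K V n)) \<le> ?g n" if "n \<ge> 2" for n
    proof -
      have bound: "real (growth A K V n) \<le> (real n * real (Suc N) + 1) ^ ?k * real C"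
        using growth_le[OF V, of n, unfolded card_index, folded C_def]
        by (metis (mono_tags, lifting) of_nat_1 of_nat_add of_nat_le_iff of_nat_mult of_nat_power)
      have ge1: "1 \<le> (real n * real (Suc N) + 1) ^ ?k * real C"
        using \<open>C > 0\<close> mult_mono[of 1 "(real n * real (Suc N) + 1) ^ ?k" 1 "real C"]
        by (simp add: one_le_power)
      show ?thesis
      proof (cases "growth A K V n = 0")
        case True
        have "0 \<le> ?g n" using that ge1 by (subst zero_le_log_cancel_iff) auto
        then show ?thesis using True by (simp add: log_def)
      next
        case False
        then show ?thesis using that bound ge1 by (subst log_le_cancel_iff) auto
      qed
    qed
    then have "limsup (\<lambda>n. ereal (log (real n) (real (growth A K V n)))) \<le> limsup (\<lambda>n. ereal (?g n))"
      by (intro Limsup_mono eventually_sequentiallyI[of 2]) simp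
    also have "(\<lambda>n. ereal (?g n)) \<longlonglongrightarrow> ereal (real ?k)"
      using log_ratio_limits(1)[of "real (Suc N)" "real C" ?k] \<open>C > 0\<close> by simp
    then have "limsup (\<lambda>n. ereal (?g n)) = ereal (real ?k)"
      by (intro lim_imp_Limsup) simp_all
    finally show "limsup (\<lambda>n. ereal (log (real n) (real (growth A K V n)))) \<le> ereal (real ?k)" .
  qed
  \<comment> \<open>For \<open>n \<ge> 2\<close> the choice \<open>q = n div ?k\<close> gives \<open>q + 1 \<ge> n / ?k\<close>;
    the value of \<open>?a\<close> for \<open>?k = 0\<close> avoids a division by zero.\<close>
  let ?a = "if ?k = 0 then 1 else real ?k"
  let ?g = "\<lambda>n. real ?k * log (real n) (real n / ?a)"
  have "?g n \<le> log (real n) (real (growth A K generator_space n))" if "n \<ge> 2" for n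
  proof -
    have n: "real n > 1" using that by simp
    let ?q = "n div ?k"
    have bound: "real (?q + 1) ^ ?k \<le> real (growth A K generator_space n)"
      using growth_generator_space_ge[of ?q n]
      by (metis of_nat_le_iff of_nat_power times_div_less_eq_dividend)
    have "?g n \<le> real ?k * log (real n) (real (?q + 1))"
    proof (cases "?k = 0")
      case False
      have "n < ?k * (?q + 1)" using False dividend_less_times_div[of ?k n] by simp
      then have "real n < real ?k * real (?q + 1)" by (metis of_nat_less_iff of_nat_mult)
      then have "real n / ?a \<le> real (?q + 1)"
        using False by (simp add: divide_le_eq mult.commute)
      moreover have "real n / ?a > 0" using False n by simp
      ultimately have "log (real n) (real n / ?a) \<le> log (real n) (real (?q + 1))"
        using n by (subst log_le_cancel_iff) auto
      then show ?thesis by (rule mult_left_mono) simp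
    qed simp
    also have "\<dots> = log (real n) (real (?q + 1) ^ ?k)" by (simp add: log_nat_power)
    also have "\<dots> \<le> log (real n) (real (growth A K generator_space n))"
    proof (subst log_le_cancel_iff)
      show "0 < real (?q + 1) ^ ?k" by simp
      then show "0 < real (growth A K generator_space n)" using bound by linarith
    qed (use n bound in auto)
    finally show ?thesis .
  qed
  then have "limsup (\<lambda>n. ereal (?g n)) \<le>
      limsup (\<lambda>n. ereal (log (real n) (real (growth A K generator_space n))))"
    by (intro Limsup_mono eventually_sequentiallyI[of 2]) simp
  moreover have "(\<lambda>n. ereal (?g n)) \<longlonglongrightarrow> ereal (real ?k)"
    using log_ratio_limits(2)[of ?a 1 ?k] by simp
  then have "limsup (\<lambda>n. ereal (?g n)) = ereal (real ?k)"
    by (intro lim_imp_Limsup) simp_all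
  ultimately show "ereal (real ?k) \<le> GK_dim A K"
    unfolding GK_dim_def using generator_space(1) by (intro SUP_upper2[of generator_space]) auto
qed

end

section \<open>The relatively free graded algebra\<close>

lemma keys_scalar: "Poly_Mapping.keys (coords (gscale c 1)) \<subseteq> {{||}}"
  by (auto simp: in_keys_iff coords_simps lookup_single when_def split: if_splits)

lemma mon_degree_empty: "mon_degree d {||} = 0"
  by (simp add: mon_degree_def)

theorem theorem1p1:
  fixes p m :: nat
    and d :: grading
    and I :: "(var, 'a::field) free_algebra set"
  assumes "infinite (UNIV :: 'a set)"
    and "CHAR('a) = p"
    and "p > 2"
    and "m \<ge> 1"
    and "I = graded_identities d \<inter> carrier (free_algebra_on (vars m))"
    and "d \<noteq> E_infty"
  shows "GK_dim (free_algebra_on (vars m) Quot I) (scalars (vars m) I) = ereal (real m)"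
proof -
  \<comment> \<open>the graded substitutions\<close>
  define \<Phi> :: "(var \<Rightarrow> 'a grassmann) set" where
    "\<Phi> = {\<phi>. \<forall>v. \<phi> v \<in> homogeneous_part d (var_degree v)}"
  define X where "X = vars m"
  define X0 where "X0 = Y ` {1..m}"
  define M where "M = 2 * card X * (CHAR('a) - 1)"
  have scalar_degree: "gscale c 1 \<in> homogeneous_part d 0" for c :: 'a
    using keys_scalar[of c] by (auto simp: homogeneous_part_def mon_degree_empty)
  have subst_mem: "(\<lambda>v. gscale (if v \<in> X0 then t v else 0) 1) \<in> \<Phi>" for t
  proof -
    have "gscale (if v \<in> X0 then t v else 0) 1 \<in> homogeneous_part d (var_degree v)" for v
      using scalar_degree by (auto simp: X0_def homogeneous_part_def zero_grassmann.rep_eq)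
    then show ?thesis by (simp add: \<Phi>_def)
  qed
  interpret Q: quotient_with_scalars X0 X M \<Phi>
  proof
    show "\<Phi> \<noteq> {}" using subst_mem by blast
    show "finite X" "X0 \<subseteq> X" by (auto simp: X_def X0_def vars_def)
    show "scalar_part (\<phi> v) = 0" if "\<phi> \<in> \<Phi>" "v \<in> X - X0" for \<phi> v
    proof -
      have "\<phi> v \<in> homogeneous_part d 1"
        using that by (auto simp: \<Phi>_def X_def X0_def vars_def) (metis var_degree.simps(2))
      then have "{||} \<notin> Poly_Mapping.keys (coords (\<phi> v))"
        by (auto simp: homogeneous_part_def mon_degree_empty)
      then show ?thesis by (simp add: scalar_part_def in_keys_iff)
    qed
    show "prod_list (map (\<lambda>v. nil_part (\<phi> v)) u) = 0" if "\<phi> \<in> \<Phi>" "set u \<subseteq> X" "length u > M" for \<phi> u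
      using that(2,3) \<open>finite X\<close> assms(2,3) unfolding M_def by (intro nil_part_words_vanish) auto
  qed (use assms(1) subst_mem in auto)
  have "Q.I = I"
    unfolding Q.I_def assms(5) graded_identities_def by (auto simp: \<Phi>_def X_def)
  then show ?thesis
    using Q.GK_dim_eq_card by (simp add: X_def X0_def card_image inj_on_def)
qed

end
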